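(* Let $E$ be a countable set with at least two elements, let $M=(m_{ij})_{i,j\in E}$ be a real matrix, and fix $k\in E$. Assume: (1) $M$ is an irreducible Metzler matrix on $E$; (2) $d_i:=\sum_{j\in E}m_{ij}<\infty$ for every $i\in E$; (3) $d:=\sup_{i\in E}m_{ii}<\infty$; (4) the matrix $\bar M=(\bar m_{ij})_{i,j\in E}$ given by $\bar m_{ij}=\dfrac{m_{ij}}{\lambda-m_{ii}}$ for $i\ne j$ and $\bar m_{ii}=0$ is recurrent on $E$, where $\lambda:=1/R_d-d$ and $R_d$ is the convergence parameter of $M+dI$. Let $Q=(q_{ij})_{i,j\in E}$ with $q_{ij}=m_{ij}-d_i\delta_{ij}$, which is a conservative irreducible $Q$-matrix, and let $(X_t)_{t\ge 0}$ be the corresponding minimal $Q$-process. Let $\xi_1=\inf\{t>0:X_t\ne X_0\}$ and $\sigma_k^+=\inf\{t\ge \xi_1:X_t=k\}$ (the first return time to $k$). Put $$u_i=\mathbb{E}_k\int_0^\infty e^{-\lambda t+\int_0^t d_{X_s}\,ds}\,I_{[X_t=i,\ t<\sigma_k^+]}\,dt,\qquad i\in E.$$ Then $u=(u_i)_{i\in E}$ satisfies $uM=\lambda u$, i.e. $\sum_{i\in E}u_i m_{ij}=\lambda u_j$ for all $j\in E$.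
   Context: A Metzler matrix here is a real matrix with $m_{ij}>0$ for all $i\neq j$ (no sign condition on diagonal entries). It is irreducible if for all $i\ne j$ in $E$ there are distinct $i=i_0,i_1,\dots,i_m=j$ in $E$ with $m_{i_0i_1}m_{i_1i_2}\cdots m_{i_{m-1}i_m}>0$. For a non-negative irreducible matrix $A$ with powers $A^n=(a^{(n)}_{ij})$, the convergence parameter is $R=\inf\{r\ge 0:\sum_{n=0}^\infty r^n a_{ij}^{(n)}=\infty\}=\sup\{r\ge 0:\sum_{n=0}^\infty r^n a_{ij}^{(n)}<\infty\}$, which is independent of $i,j$. This notion is applied to $M+dI$, which the source takes to be non-negative and irreducible; the source also asserts that $\lambda>m_{ii}$ for all $i\in E$, so that $\bar M$ is well defined and non-negative. "$\bar M$ is recurrent" means it is $1$-recurrent: its convergence parameter is $1$ and $\sum_{n=0}^\infty \bar m_{ij}^{(n)}=\infty$, where $\bar M^n=(\bar m_{ij}^{(n)})$. The minimal $Q$-process is the continuous-time Markov jump process with rate matrix $Q$, killed at its explosion time if it explodes. $\mathbb{E}_k$ denotes expectation given $X_0=k$; $\inf\emptyset=\infty$; $I_{[\cdot]}$ is an indicator; $\delta_{ij}$ is the Kronecker delta; $I$ in $M+dI$ is the identity matrix. *)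

theory Defs
  imports "HOL-Probability.Probability"
begin

definition metzler :: "('e \<Rightarrow> 'e \<Rightarrow> real) \<Rightarrow> bool" where
  "metzler m \<longleftrightarrow> (\<forall>i j. i \<noteq> j \<longrightarrow> 0 < m i j)"

definition irreducible_matrix :: "('e \<Rightarrow> 'e \<Rightarrow> real) \<Rightarrow> bool" where
  "irreducible_matrix m \<longleftrightarrow>
     (\<forall>i j. i \<noteq> j \<longrightarrow>
        (\<exists>n p. p 0 = i \<and> p n = j \<and> inj_on p {..n} \<and> 0 < (\<Prod>l<n. m (p l) (p (Suc l)))))"

text \<open>Powers of a non-negative matrix. Their entries are infinite sums that may diverge,
  hence the values in \<^typ>\<open>ennreal\<close>. Because of the coercion \<^const>\<open>ennreal\<close>, which sends negative
  reals to 0, this and the notions below are meaningful for non-negative matrices only.\<close>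

fun matpow :: "('e \<Rightarrow> 'e \<Rightarrow> real) \<Rightarrow> nat \<Rightarrow> 'e \<Rightarrow> 'e \<Rightarrow> ennreal" where
  "matpow A 0 i j = (if i = j then 1 else 0)"
| "matpow A (Suc n) i j = (\<Sum>\<^sub>\<infinity>l. ennreal (A i l) * matpow A n l j)"

text \<open>For a non-negative irreducible matrix the value does not depend on the entry \<open>i j\<close>.\<close>

definition convergence_parameter :: "('e \<Rightarrow> 'e \<Rightarrow> real) \<Rightarrow> 'e \<Rightarrow> 'e \<Rightarrow> ennreal" where
  "convergence_parameter A i j =
     Inf {ennreal r | r. 0 \<le> r \<and> (\<Sum>n. ennreal (r ^ n) * matpow A n i j) = \<infinity>}"

definition recurrent_matrix :: "('e \<Rightarrow> 'e \<Rightarrow> real) \<Rightarrow> bool" where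
  "recurrent_matrix A \<longleftrightarrow>
     (\<forall>i j. convergence_parameter A i j = 1 \<and> (\<Sum>n. matpow A n i j) = \<infinity>)"

definition exit_rate :: "('e \<Rightarrow> 'e \<Rightarrow> real) \<Rightarrow> 'e \<Rightarrow> real" where
  "exit_rate Q i = - Q i i"

definition jump_prob :: "('e \<Rightarrow> 'e \<Rightarrow> real) \<Rightarrow> 'e \<Rightarrow> 'e \<Rightarrow> real" where
  "jump_prob Q i j = (if i = j then 0 else Q i j / exit_rate Q i)"

text \<open>\<open>minimal_Q_process Q k P X\<close>: on the probability space \<open>P\<close>, \<open>X\<close> is the Markov jump process
  with rate matrix \<open>Q\<close>, started in \<open>k\<close> and killed at its explosion time; \<^const>\<open>None\<close> is the
  cemetery state. \<open>Y\<close> is the jump chain and \<open>S\<close> is the sequence of holding times, so that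
  \<open>\<Sum>l<n. S l\<close> is the time of the \<open>n\<close>-th jump. The displayed joint law says that \<open>Y\<close> is a
  discrete-time Markov chain from \<open>k\<close> with transition matrix \<^term>\<open>jump_prob Q\<close> and that, given
  \<open>Y\<close>, the \<open>S l\<close> are independent and exponentially distributed with parameters
  \<open>exit_rate Q (Y l)\<close>. Holding times are finite, so this is for rate matrices without absorbing
  states, such as irreducible ones on at least two states.\<close>

definition minimal_Q_process ::
    "('e \<Rightarrow> 'e \<Rightarrow> real) \<Rightarrow> 'e \<Rightarrow> 'w measure \<Rightarrow> (real \<Rightarrow> 'w \<Rightarrow> 'e option) \<Rightarrow> bool" where
  "minimal_Q_process Q k P X \<longleftrightarrow>
     prob_space P \<and>
     (\<exists>(Y :: nat \<Rightarrow> 'w \<Rightarrow> 'e) (S :: nat \<Rightarrow> 'w \<Rightarrow> real).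
        (\<forall>n. Y n \<in> measurable P (count_space UNIV)) \<and>
        (\<forall>n. S n \<in> borel_measurable P) \<and>
        (\<forall>n. \<forall>\<omega>\<in>space P. 0 < S n \<omega>) \<and>
        (\<forall>n (y :: nat \<Rightarrow> 'e) (t :: nat \<Rightarrow> real). (\<forall>l\<le>n. 0 \<le> t l) \<longrightarrow>
           measure P {\<omega> \<in> space P. \<forall>l\<le>n. Y l \<omega> = y l \<and> t l < S l \<omega>} =
             (if y 0 = k then 1 else 0) * (\<Prod>l<n. jump_prob Q (y l) (y (Suc l)))
               * (\<Prod>l\<le>n. exp (- exit_rate Q (y l) * t l))) \<and>
        (\<forall>\<omega>\<in>space P. \<forall>t\<ge>0.
           (\<forall>n. (\<Sum>l<n. S l \<omega>) \<le> t \<and> t < (\<Sum>l<Suc n. S l \<omega>) \<longrightarrow> X t \<omega> = Some (Y n \<omega>)) \<and>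
           ((\<forall>n. (\<Sum>l<n. S l \<omega>) \<le> t) \<longrightarrow> X t \<omega> = None)))"

definition first_jump_time :: "(real \<Rightarrow> 'w \<Rightarrow> 'e option) \<Rightarrow> 'w \<Rightarrow> ereal" where
  "first_jump_time X \<omega> = Inf {ereal t | t. 0 < t \<and> X t \<omega> \<noteq> X 0 \<omega>}"

definition return_time :: "(real \<Rightarrow> 'w \<Rightarrow> 'e option) \<Rightarrow> 'e \<Rightarrow> 'w \<Rightarrow> ereal" where
  "return_time X k \<omega> = Inf {ereal t | t. first_jump_time X \<omega> \<le> ereal t \<and> X t \<omega> = Some k}"

text \<open>The integral of \<open>f\<close> along the path up to time \<open>t\<close>; the value 0 at the cemetery state is a
  convention, which has no effect when the process is alive at time \<open>t\<close>.\<close>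

definition path_integral :: "('e \<Rightarrow> real) \<Rightarrow> (real \<Rightarrow> 'w \<Rightarrow> 'e option) \<Rightarrow> real \<Rightarrow> 'w \<Rightarrow> real" where
  "path_integral f X t \<omega> =
     (LINT s:{0..t}|lborel. (case X s \<omega> of None \<Rightarrow> 0 | Some j \<Rightarrow> f j))"

end

theory Submission imports Defs begin

text \<open>
  Let \<open>q\<^sub>i = d\<^sub>i - m\<^sub>i\<^sub>i\<close> be the exit rates. A sojourn in \<open>i\<close> contributes the weight
  \<open>E exp ((d\<^sub>i - \<lambda>) S) = q\<^sub>i / (\<lambda> - m\<^sub>i\<^sub>i)\<close>, which turns the jump probability \<open>m\<^sub>i\<^sub>j / q\<^sub>i\<close> into the
  entry \<open>i j\<close> of \<open>Mbar\<close>, while the last, unfinished sojourn contributes the integral \<open>1 / (\<lambda> - m\<^sub>i\<^sub>i)\<close>.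
  Hence \<open>u\<^sub>i = v\<^sub>i / (\<lambda> - m\<^sub>i\<^sub>i)\<close>, where \<open>v\<^sub>i\<close> is the total \<open>Mbar\<close>-weight of the paths from \<open>k\<close> to \<open>i\<close>
  that do not return to \<open>k\<close>. Extending such paths by one step gives \<open>v Mbar = v\<close> away from \<open>k\<close>; at
  \<open>k\<close> the equation says that the total weight of the first returns is 1, which is the recurrence of
  \<open>Mbar\<close>. Finally \<open>v Mbar = v\<close> is \<open>u M = \<lambda> u\<close> in other terms. That
  \<open>m\<^sub>i\<^sub>i < \<lambda>\<close> is forced by recurrence: otherwise row \<open>i\<close> of \<open>Mbar\<close> would have no positive entry.
\<close>

section \<open>Recurrence of a non-negative matrix\<close>

lemma nn_integral_count_space_eq_infsum:
  fixes f :: "'a::countable \<Rightarrow> ennreal"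
  shows "(\<integral>\<^sup>+x. f x \<partial>count_space UNIV) = (\<Sum>\<^sub>\<infinity>x. f x)"
proof (cases "finite (UNIV :: 'a set)")
  case True
  then show ?thesis
    by (simp add: nn_integral_count_space_finite)
next
  case False
  define g :: "nat \<Rightarrow> 'a" where "g = from_nat_into UNIV"
  have g: "bij_betw g UNIV UNIV"
    unfolding g_def using False by (intro bij_betw_from_nat_into) auto
  have "(\<integral>\<^sup>+x. f x \<partial>count_space UNIV) = (\<Sum>n. f (g n))"
    using nn_integral_bij_count_space[OF g, of f] by (simp add: nn_integral_count_space_nat)
  also have "\<dots> = (\<Sum>\<^sub>\<infinity>n. f (g n))"
    by (intro sums_unique[symmetric] has_sum_imp_sums has_sum_infsum nonneg_summable_on_complete) auto
  also have "\<dots> = (\<Sum>\<^sub>\<infinity>x. f x)"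
    using infsum_reindex_bij_betw[OF g, of f] by simp
  finally show ?thesis .
qed

text \<open>The way back to real sums at the end: the integral bounds every finite partial sum by
  \<open>c\<close>, so a nonnegative real family is summable, and its sum is then identified in
  \<open>ennreal\<close>.\<close>

lemma has_sum_if_nn_integral_count_space:
  fixes f :: "'a::countable \<Rightarrow> real"
  assumes nonneg: "\<And>x. 0 \<le> f x" and "0 \<le> c"
    and eq: "(\<integral>\<^sup>+x. ennreal (f x) \<partial>count_space UNIV) = ennreal c"
  shows "(f has_sum c) UNIV"
proof -
  have le: "sum f F \<le> c" if "finite F" for F
  proof -
    have "ennreal (sum f F) = (\<integral>\<^sup>+x. ennreal (f x) * indicator F x \<partial>count_space UNIV)"
      using that nonneg
      by (simp add: nn_integral_count_space_indicator[symmetric] nn_integral_count_space_finite sum_ennreal)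
    also have "\<dots> \<le> ennreal c"
      unfolding eq[symmetric] by (intro nn_integral_mono) (auto simp: indicator_def)
    finally show ?thesis
      using \<open>0 \<le> c\<close> by simp
  qed
  have summable: "f summable_on UNIV"
    by (rule nonneg_bdd_above_summable_on) (auto intro!: bdd_aboveI[of _ c] le nonneg)
  have "ennreal (infsum f UNIV) = (\<Sum>\<^sub>\<infinity>x. ennreal (f x))"
    using infsum_nonneg_is_SUPREMUM_ennreal[OF summable nonneg]
    by (subst nonneg_infsum_complete) (auto intro!: SUP_cong simp: sum_ennreal nonneg)
  then have "ennreal (infsum f UNIV) = ennreal c"
    by (simp add: eq[symmetric] nn_integral_count_space_eq_infsum)
  then have "infsum f UNIV = c"
    using \<open>0 \<le> c\<close> by (simp add: infsum_nonneg nonneg)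
  with summable show ?thesis
    using has_sum_infsum by blast
qed

text \<open>Total weight of the paths of length \<open>n\<close> from \<open>k\<close> to
  \<open>j\<close> that avoid \<open>k\<close> at the times 1 to \<open>n\<close>. The recursion
  appends the last step, whereas \<open>matpow\<close> splits off the first one, so that the two can
  be concatenated.\<close>

fun taboo_pow :: "('e \<Rightarrow> 'e \<Rightarrow> real) \<Rightarrow> 'e \<Rightarrow> nat \<Rightarrow> 'e \<Rightarrow> ennreal" where
  "taboo_pow A k 0 j = (if j = k then 1 else 0)"
| "taboo_pow A k (Suc n) j =
     (if j = k then 0 else (\<integral>\<^sup>+i. taboo_pow A k n i * ennreal (A i j) \<partial>count_space UNIV))"

text \<open>Index \<open>n\<close> belongs to the first returns at time \<open>n + 1\<close>.\<close>

definition first_return :: "('e \<Rightarrow> 'e \<Rightarrow> real) \<Rightarrow> 'e \<Rightarrow> nat \<Rightarrow> ennreal" where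
  "first_return A k n = (\<integral>\<^sup>+i. taboo_pow A k n i * ennreal (A i k) \<partial>count_space UNIV)"

text \<open>Shifts the border between the taboo part and the free part of a closed path by one step:
  at time \<open>n + 1\<close> the path is either back in \<open>k\<close> for the first time, with
  \<open>m\<close> free steps left, or still avoids \<open>k\<close>.\<close>

lemma nn_integral_taboo_pow_matpow_Suc:
  fixes A :: "'e::countable \<Rightarrow> 'e \<Rightarrow> real"
  shows "(\<integral>\<^sup>+i. taboo_pow A k n i * matpow A (Suc m) i k \<partial>count_space UNIV) =
    first_return A k n * matpow A m k k
      + (\<integral>\<^sup>+i. taboo_pow A k (Suc n) i * matpow A m i k \<partial>count_space UNIV)"
proof -
  have "(\<integral>\<^sup>+i. taboo_pow A k n i * matpow A (Suc m) i k \<partial>count_space UNIV) =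
    (\<integral>\<^sup>+i. (\<integral>\<^sup>+j. taboo_pow A k n i * ennreal (A i j) * matpow A m j k \<partial>count_space UNIV)
      \<partial>count_space UNIV)"
    by (simp add: nn_integral_count_space_eq_infsum[symmetric] nn_integral_cmult[symmetric] mult.assoc)
  also have "\<dots> = (\<integral>\<^sup>+j. (\<integral>\<^sup>+i. taboo_pow A k n i * ennreal (A i j) * matpow A m j k
      \<partial>count_space UNIV) \<partial>count_space UNIV)"
    by (rule pair_sigma_finite.Fubini')
       (auto simp: pair_sigma_finite_def sigma_finite_measure_count_space pair_measure_countable)
  also have "\<dots> = (\<integral>\<^sup>+j. (if j = k then first_return A k n * matpow A m k k else 0)
      + taboo_pow A k (Suc n) j * matpow A m j k \<partial>count_space UNIV)"
    by (intro nn_integral_cong) (auto simp: nn_integral_multc first_return_def)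
  also have "\<dots> = (\<integral>\<^sup>+j. first_return A k n * matpow A m k k * indicator {k} j \<partial>count_space UNIV)
      + (\<integral>\<^sup>+i. taboo_pow A k (Suc n) i * matpow A m i k \<partial>count_space UNIV)"
    by (subst nn_integral_add[symmetric]) (auto intro!: nn_integral_cong)
  also have "(\<integral>\<^sup>+j. first_return A k n * matpow A m k k * indicator {k} j \<partial>count_space UNIV)
      = first_return A k n * matpow A m k k"
    by (subst nn_integral_cmult_indicator) auto
  finally show ?thesis .
qed


lemma nn_integral_taboo_pow_matpow_0:
  "(\<integral>\<^sup>+i. taboo_pow A k n i * matpow A 0 i k \<partial>count_space UNIV) = (if n = 0 then 1 else 0)"
proof -
  have "(\<integral>\<^sup>+i. taboo_pow A k n i * matpow A 0 i k \<partial>count_space UNIV) =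
      (\<integral>\<^sup>+i. (if n = 0 then 1 else 0) * indicator {k} i \<partial>count_space UNIV)"
    by (intro nn_integral_cong, cases n) (auto simp: indicator_def)
  then show ?thesis
    by (subst (asm) nn_integral_cmult_indicator) auto
qed

lemma nn_integral_taboo_pow_0_matpow:
  "(\<integral>\<^sup>+i. taboo_pow A k 0 i * matpow A m i k \<partial>count_space UNIV) = matpow A m k k"
proof -
  have "(\<integral>\<^sup>+i. taboo_pow A k 0 i * matpow A m i k \<partial>count_space UNIV) =
      (\<integral>\<^sup>+i. matpow A m k k * indicator {k} i \<partial>count_space UNIV)"
    by (auto intro!: nn_integral_cong simp: indicator_def)
  then show ?thesis
    by (subst (asm) nn_integral_cmult_indicator) auto
qed

text \<open>\<open>A\<close> need not be stochastic, so neither inequality is a bound on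
  probabilities. The convergence parameter 1 yields that the sum is at most 1, the divergence of the
  series of powers that it is at least 1.\<close>

lemma first_return_suminf_eq_1:
  fixes A :: "'e::countable \<Rightarrow> 'e \<Rightarrow> real"
  assumes "recurrent_matrix A"
  shows "(\<Sum>n. first_return A k n) = 1"
proof -
  \<comment> \<open>Weight of the closed paths at \<open>k\<close> of length \<open>n + m\<close>
    that avoid \<open>k\<close> at the times 1 to \<open>n\<close>.\<close>
  define a where "a n m = (\<integral>\<^sup>+i. taboo_pow A k n i * matpow A m i k \<partial>count_space UNIV)" for n m
  define f where "f = first_return A k"
  define p where "p m = matpow A m k k" for m
  have a_Suc: "a n (Suc m) = f n * p m + a (Suc n) m" for n m
    by (simp only: a_def f_def p_def nn_integral_taboo_pow_matpow_Suc)
  have a_0: "a n 0 = (if n = 0 then 1 else 0)" for n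
    unfolding a_def by (rule nn_integral_taboo_pow_matpow_0)
  have a0: "a 0 m = p m" for m
    unfolding a_def p_def by (rule nn_integral_taboo_pow_0_matpow)
  have p_suminf: "(\<Sum>n. p n) = \<infinity>" and cp: "convergence_parameter A k k = 1"
    using assms by (auto simp: recurrent_matrix_def p_def)
  have p_finite: "(\<Sum>n. ennreal (r ^ n) * p n) < \<infinity>" if r: "0 \<le> r" "r < 1" for r
  proof (rule ccontr)
    assume "\<not> ?thesis"
    then have "ennreal r \<in> {ennreal r | r. 0 \<le> r \<and> (\<Sum>n. ennreal (r ^ n) * p n) = \<infinity>}"
      using r by (intro CollectI exI[of _ r]) (simp add: not_less top_unique)
    then have "1 \<le> ennreal r"
      using cp unfolding convergence_parameter_def p_def by (metis (lifting) Inf_lower)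
    with r show False by simp
  qed
  \<comment> \<open>Any \<open>r\<close> strictly between 0 and 1 would do: the positive factor
    \<open>r ^ n\<close> cannot hide an infinite entry.\<close>
  have p_less_top: "p n < \<infinity>" for n
  proof -
    have "ennreal ((1/2) ^ n) * p n < \<infinity>"
      using p_finite[of "1/2"] ennreal_suminf_lessD[of "\<lambda>n. ennreal ((1/2) ^ n) * p n" \<infinity> n] by simp
    then show ?thesis
      by (auto simp: less_top[symmetric] ennreal_mult_eq_top_iff ennreal_eq_0_iff simp flip: not_less)
  qed

  \<comment> \<open>The term \<open>m = 0\<close> gives the constant, and the others lose one free
    step, whence \<open>N - 1\<close>. The sum next to \<open>f s\<close> is enlarged back to
    \<open>N\<close>, so that all iterations share the same factor.\<close>
  have p_part: "(\<Sum>m<N. a s m) \<le> (if s = 0 then 1 else 0) + f s * (\<Sum>m<N. p m) + (\<Sum>m<N-1. a (Suc s) m)"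
    for N s
  proof (cases N)
    case (Suc N')
    have "(\<Sum>m<N'. a s (Suc m)) = f s * (\<Sum>m<N'. p m) + (\<Sum>m<N'. a (Suc s) m)"
      by (simp add: a_Suc sum.distrib sum_distrib_left)
    moreover have "f s * (\<Sum>m<N'. p m) \<le> f s * (\<Sum>m<N. p m)"
      unfolding Suc by (intro mult_left_mono sum_mono2) auto
    ultimately show ?thesis
      by (simp add: Suc sum.lessThan_Suc_shift a_0 add.assoc del: sum.lessThan_Suc)
  qed simp
  \<comment> \<open>Iterating \<open>a_Suc\<close> gives the renewal equation \<open>p(r) = 1 + r f(r) p(r)\<close> of power series. It is used
    truncated at \<open>r = 1\<close> for \<open>f \<ge> 1\<close>, and at \<open>r < 1\<close>, where \<open>p\<close> converges, for \<open>f \<le> 1\<close>.\<close>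
  have upper: "(\<Sum>m<N. p m) \<le> 1 + (\<Sum>s<N. f s) * (\<Sum>m<N. p m)" for N
  proof -
    have "(\<Sum>m<N. a 0 m) \<le> (if K = 0 then 0 else 1) + (\<Sum>s<K. f s) * (\<Sum>m<N. p m) + (\<Sum>m<N-K. a K m)"
      if "K \<le> N" for K
      using that
    proof (induction K)
      case (Suc K)
      have "(\<Sum>m<N-K. p m) \<le> (\<Sum>m<N. p m)"
        by (intro sum_mono2) auto
      then have "(\<Sum>m<N-K. a K m) \<le> (if K = 0 then 1 else 0) + f K * (\<Sum>m<N. p m) + (\<Sum>m<N-Suc K. a (Suc K) m)"
        using p_part[where N = "N - K" and s = K]
        by (elim order.trans) (auto intro!: add_mono mult_left_mono)
      then have "(if K = 0 then 0 else 1) + (\<Sum>s<K. f s) * (\<Sum>m<N. p m) + (\<Sum>m<N-K. a K m)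
          \<le> (if K = 0 then 0 else 1) + (\<Sum>s<K. f s) * (\<Sum>m<N. p m)
            + ((if K = 0 then 1 else 0) + f K * (\<Sum>m<N. p m) + (\<Sum>m<N-Suc K. a (Suc K) m))"
        by (intro add_left_mono)
      also have "\<dots> = 1 + (\<Sum>s<Suc K. f s) * (\<Sum>m<N. p m) + (\<Sum>m<N-Suc K. a (Suc K) m)"
        by (simp add: algebra_simps)
      finally show ?case
        using Suc by (auto intro: order.trans)
    qed simp
    \<comment> \<open>At \<open>K = N\<close> the remainder is an empty sum.\<close>
    from this[of N] show ?thesis
      by (auto simp: a0 intro: order.trans)
  qed
  have lower: "(\<Sum>s<K. ennreal (r ^ Suc s) * f s) \<le> 1" if r: "0 < r" "r < 1" for r K
  proof -
    define PP where "PP = (\<Sum>m. ennreal (r ^ m) * p m)"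
    have step: "(\<Sum>m. ennreal (r ^ m) * a s m) =
        (if s = 0 then 1 else 0) + ennreal r * f s * PP + ennreal r * (\<Sum>m. ennreal (r ^ m) * a (Suc s) m)" for s
    proof -
      have "(\<Sum>m. ennreal (r ^ m) * a s m) = a s 0 + (\<Sum>m. ennreal (r ^ Suc m) * a s (Suc m))"
        by (subst suminf_offset[of _ 1]) auto
      also have "(\<Sum>m. ennreal (r ^ Suc m) * a s (Suc m)) =
          (\<Sum>m. ennreal r * f s * (ennreal (r ^ m) * p m) + ennreal r * (ennreal (r ^ m) * a (Suc s) m))"
        using r by (simp add: a_Suc ennreal_mult algebra_simps)
      also have "\<dots> = ennreal r * f s * PP + ennreal r * (\<Sum>m. ennreal (r ^ m) * a (Suc s) m)"
        by (simp add: suminf_add[symmetric] PP_def)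
      finally show ?thesis by (simp add: a_0 add.assoc)
    qed
    have "(\<Sum>m. ennreal (r ^ m) * a 0 m) \<ge>
        (if K = 0 then 0 else 1) + (\<Sum>s<K. ennreal (r ^ Suc s) * f s) * PP + ennreal (r ^ K) * (\<Sum>m. ennreal (r ^ m) * a K m)"
    proof (induction K)
      case (Suc K)
      show ?case
        using r by (intro order.trans[OF _ Suc.IH]) (subst step, auto simp: ennreal_mult algebra_simps)
    qed simp
    then have le: "(if K = 0 then 0 else 1) + (\<Sum>s<K. ennreal (r ^ Suc s) * f s) * PP \<le> PP"
      by (auto simp: a0 PP_def intro: order.trans[OF add_increasing2])
    have "PP < \<infinity>" unfolding PP_def using p_finite r by simp
    show ?thesis
    proof (rule ccontr)
      assume "\<not> ?thesis"
      then have "K \<noteq> 0" and *: "1 \<le> (\<Sum>s<K. ennreal (r ^ Suc s) * f s)"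
        by (auto intro!: gr0I)
      \<comment> \<open>A coefficient of at least 1 would give \<open>1 + PP\<close> at most
        \<open>PP\<close>, which only an infinite \<open>PP\<close> allows.\<close>
      have "1 + PP \<le> 1 + (\<Sum>s<K. ennreal (r ^ Suc s) * f s) * PP"
        using mult_right_mono[OF *, of PP] by (intro add_left_mono) simp
      also have "\<dots> \<le> PP" using le \<open>K \<noteq> 0\<close> by simp
      finally show False
        using \<open>PP < \<infinity>\<close> by (cases PP) (auto simp: ennreal_plus[symmetric] ennreal_1[symmetric] simp del: ennreal_plus ennreal_1)
    qed
  qed
  have f_part_le: "(\<Sum>s<K. f s) \<le> 1" for K
  proof (rule ccontr)
    assume "\<not> ?thesis"
    then have gt: "1 < (\<Sum>s<K. f s)" by simp
    \<comment> \<open>A finite partial sum is continuous in \<open>r\<close>, so its bound survives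
      the limit from the left at 1.\<close>
    have "((\<lambda>r. \<Sum>s<K. ennreal (r ^ Suc s) * f s) \<longlongrightarrow> (\<Sum>s<K. ennreal (1 ^ Suc s) * f s)) (at_left 1)"
      by (intro tendsto_sum tendsto_mult_ennreal tendsto_intros) auto
    then have "(\<Sum>s<K. f s) \<le> 1"
      by (intro tendsto_upperbound[of _ _ "at_left (1::real)"])
         (auto intro!: eventually_at_leftI[of 0] simp: lower[simplified])
    with gt show False by simp
  qed
  have "(\<Sum>n. f n) \<le> 1"
    by (intro suminf_le_const f_part_le) auto
  moreover have "(\<Sum>n. f n) \<ge> 1"
  proof (rule ccontr)
    define F where "F = (\<Sum>n. f n)"
    assume "\<not> ?thesis"
    then have "F < 1" by (simp add: F_def)
    \<comment> \<open>For \<open>F < 1\<close> the inequality \<open>upper\<close> can be solved for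
      the finite partial sum; the bound is uniform in \<open>N\<close> and contradicts
      divergence.\<close>
    have "(\<Sum>m<N. p m) \<le> 1 / (1 - F)" for N
    proof -
      define x where "x = (\<Sum>m<N. p m)"
      have "x < \<infinity>" using p_less_top by (simp add: x_def less_top)
      have "x \<le> 1 + F * x"
        unfolding x_def F_def
        by (rule order.trans[OF upper]) (intro add_left_mono mult_right_mono sum_le_suminf, auto)
      obtain F' where F': "F = ennreal F'" "0 \<le> F'" "F' < 1"
        using \<open>F < 1\<close> by (cases F) auto
      obtain x' where x': "x = ennreal x'" "0 \<le> x'"
        using \<open>x < \<infinity>\<close> by (cases x) auto
      have "x' \<le> 1 + F' * x'"
        using \<open>x \<le> 1 + F * x\<close> F' x'
        by (simp add: ennreal_mult[symmetric] ennreal_plus[symmetric] ennreal_1[symmetric] del: ennreal_plus ennreal_1)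
      then have "x' \<le> 1 / (1 - F')"
        using F' by (simp add: field_simps)
      moreover have "1 / (1 - F) = ennreal (1 / (1 - F'))"
        using F' by (simp add: ennreal_1[symmetric] ennreal_minus divide_ennreal del: ennreal_1)
      ultimately show "x \<le> 1 / (1 - F)" using x' by (simp add: ennreal_leI)
    qed
    then have "(\<Sum>m. p m) \<le> 1 / (1 - F)"
      by (intro suminf_le_const) auto
    moreover have "1 / (1 - F) < \<infinity>"
      using \<open>F < 1\<close>
      by (cases F) (auto simp: ennreal_1[symmetric] ennreal_minus divide_ennreal ennreal_less_iff simp del: ennreal_1)
    ultimately show False using p_suminf by simp
  qed
  ultimately show ?thesis by (simp add: f_def)
qed

section \<open>The invariant vector of a recurrent matrix\<close>

lemma taboo_pow_suminf_taboo_state: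
  "(\<Sum>n. taboo_pow A k n k) = 1"
proof -
  have "(\<Sum>n. taboo_pow A k n k) = (\<Sum>n\<in>{0}. taboo_pow A k n k)"
    by (rule suminf_finite) (auto elim: taboo_pow.elims intro: gr0_implies_Suc simp: gr0_conv_Suc)
  then show ?thesis by simp
qed

text \<open>Applying \<open>A\<close> appends one step to the taboo paths. Away from
  \<open>k\<close> this only drops the index 0, which carries no weight there; at \<open>k\<close>
  it produces the first returns, whose weight 1 matches that of the empty path.\<close>

lemma taboo_pow_suminf_invariant:
  fixes A :: "'e::countable \<Rightarrow> 'e \<Rightarrow> real"
  assumes "recurrent_matrix A"
  shows "(\<integral>\<^sup>+i. (\<Sum>n. taboo_pow A k n i) * ennreal (A i j) \<partial>count_space UNIV) = (\<Sum>n. taboo_pow A k n j)"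
proof -
  have *: "(\<integral>\<^sup>+i. (\<Sum>n. taboo_pow A k n i) * ennreal (A i j) \<partial>count_space UNIV) =
      (\<Sum>n. \<integral>\<^sup>+i. taboo_pow A k n i * ennreal (A i j) \<partial>count_space UNIV)"
    by (subst nn_integral_suminf[symmetric]) auto
  show ?thesis
  proof (cases "j = k")
    case True
    then show ?thesis
      using * first_return_suminf_eq_1[OF assms, of k]
      by (simp add: first_return_def taboo_pow_suminf_taboo_state)
  next
    case False
    have "(\<Sum>n. taboo_pow A k n j) = (\<Sum>n. taboo_pow A k (Suc n) j)"
      using False by (subst suminf_offset[of _ 1]) auto
    with * False show ?thesis by simp
  qed
qed

text \<open>Without a positive entry in row \<open>i\<close>, all positive powers vanish on that row
  and the series at \<open>i i\<close> is 1. No sign of \<open>A\<close> is presupposed, as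
  nonpositive entries become 0 in \<open>ennreal\<close>.\<close>

lemma recurrent_matrix_row_pos:
  fixes A :: "'e::countable \<Rightarrow> 'e \<Rightarrow> real"
  assumes "recurrent_matrix A"
  shows "\<exists>j. 0 < A i j"
proof (rule ccontr)
  assume "\<not> ?thesis"
  then have "ennreal (A i j) = 0" for j
    by (auto simp: ennreal_eq_0_iff not_less)
  then have "matpow A n i i = 0" if "n \<noteq> 0" for n
    using that by (cases n) auto
  then have "(\<Sum>n. matpow A n i i) = (\<Sum>n\<in>{0}. matpow A n i i)"
    by (intro suminf_finite) auto
  then show False
    using assms by (auto simp: recurrent_matrix_def)
qed

text \<open>By invariance at \<open>k\<close>, the single term of index \<open>i\<close> is at most
  the value 1 at \<open>k\<close>; the positive factor \<open>A i k\<close> can then be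
  dropped.\<close>

lemma taboo_pow_suminf_finite:
  fixes A :: "'e::countable \<Rightarrow> 'e \<Rightarrow> real"
  assumes "recurrent_matrix A" and pos: "\<And>i. i \<noteq> k \<Longrightarrow> 0 < A i k"
  shows "(\<Sum>n. taboo_pow A k n i) < \<infinity>"
proof (cases "i = k")
  case False
  have "(\<Sum>n. taboo_pow A k n i) * ennreal (A i k) =
      (\<integral>\<^sup>+j. (\<Sum>n. taboo_pow A k n j) * ennreal (A j k) * indicator {i} j \<partial>count_space UNIV)"
    by (simp add: nn_integral_count_space_indicator[symmetric] nn_integral_count_space_finite)
  also have "\<dots> \<le> (\<integral>\<^sup>+j. (\<Sum>n. taboo_pow A k n j) * ennreal (A j k) \<partial>count_space UNIV)"
    by (intro nn_integral_mono) (auto simp: indicator_def)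
  also have "\<dots> = 1"
    by (simp add: taboo_pow_suminf_invariant[OF assms(1)] taboo_pow_suminf_taboo_state)
  finally have "(\<Sum>n. taboo_pow A k n i) * ennreal (A i k) < \<infinity>"
    by (rule le_less_trans) simp
  with pos[OF False] show ?thesis
    by (auto simp: less_top[symmetric] ennreal_mult_eq_top_iff ennreal_eq_0_iff simp flip: not_less)
qed (simp add: taboo_pow_suminf_taboo_state)

section \<open>The joint law of jump chain and holding times\<close>

text \<open>The events \<open>a < S i x\<close> form an intersection-stable generator, so it
  suffices that their probabilities factorize. Negative thresholds can be raised to 0 because the
  joint law at 0 makes all \<open>S i\<close> almost surely positive.\<close>

lemma (in prob_space) exponential_jointD:
  fixes S :: "'i \<Rightarrow> 'a \<Rightarrow> real"
  assumes "finite I"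
    and meas [measurable]: "\<And>i. S i \<in> borel_measurable M"
    and q_pos: "\<And>i. i \<in> I \<Longrightarrow> 0 < q i"
    and joint: "\<And>t. (\<forall>i\<in>I. 0 \<le> t i) \<Longrightarrow>
      prob {x \<in> space M. \<forall>i\<in>I. t i < S i x} = (\<Prod>i\<in>I. exp (- q i * t i))"
  shows "indep_vars (\<lambda>_. borel) S I"
    and "\<And>i. i \<in> I \<Longrightarrow> distributed M lborel (S i) (exponential_density (q i))"
proof -
  have "prob {x \<in> space M. \<forall>i\<in>I. 0 < S i x} = 1"
    using joint[of "\<lambda>_. 0"] by simp
  then have S_pos: "AE x in M. \<forall>i\<in>I. 0 < S i x"
    using \<open>finite I\<close> by (subst (asm) prob_Collect_eq_1) auto
  have marg: "prob (\<Inter>j\<in>J. {x \<in> space M. a j < S j x}) = (\<Prod>j\<in>J. exp (- q j * max 0 (a j)))"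
    if J: "J \<subseteq> I" "J \<noteq> {}" for J a
  proof -
    \<comment> \<open>Threshold 0 outside \<open>J\<close> contributes the factor
      \<open>exp 0\<close>, which turns the joint law into the marginal law on
      \<open>J\<close>.\<close>
    define t where "t i = (if i \<in> J then max 0 (a i) else 0)" for i
    have "finite J" using J \<open>finite I\<close> by (auto intro: finite_subset)
    have "prob (\<Inter>j\<in>J. {x \<in> space M. a j < S j x}) = prob {x \<in> space M. \<forall>i\<in>I. t i < S i x}"
    proof (rule measure_eq_AE)
      show "AE x in M. x \<in> (\<Inter>j\<in>J. {x \<in> space M. a j < S j x}) \<longleftrightarrow> x \<in> {x \<in> space M. \<forall>i\<in>I. t i < S i x}"
        using S_pos AE_space
      proof eventually_elim
        case (elim x)
        then show ?case using J by (auto simp: t_def)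
      qed
    qed (use \<open>finite I\<close> \<open>finite J\<close> J in auto)
    also have "\<dots> = (\<Prod>i\<in>I. exp (- q i * t i))"
      by (rule joint) (simp add: t_def)
    also have "\<dots> = (\<Prod>j\<in>J. exp (- q j * max 0 (a j)))"
      using J \<open>finite I\<close> by (intro prod.mono_neutral_cong_right) (auto simp: t_def)
    finally show ?thesis .
  qed
  have marg1: "prob {x \<in> space M. a < S i x} = exp (- q i * max 0 a)" if "i \<in> I" for i a
    using marg[of "{i}" "\<lambda>_. a"] that by simp
  show "distributed M lborel (S i) (exponential_density (q i))" if "i \<in> I" for i
  proof (subst exponential_distributed_iff[OF q_pos[OF that]], intro conjI allI impI)
    fix a :: real assume "0 \<le> a"
    have "prob {x \<in> space M. S i x \<le> a} = 1 - prob {x \<in> space M. \<not> S i x \<le> a}"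
      by (subst prob_neg) auto
    then show "prob {x \<in> space M. S i x \<le> a} = 1 - exp (- a * q i)"
      using marg1[OF that, of a] \<open>0 \<le> a\<close> by (simp add: not_le mult.commute)
  qed simp
  define F where "F i = {{x \<in> space M. a < S i x} | a. True}" for i
  have "indep_sets F I"
  proof (rule indep_setsI)
    show "F i \<subseteq> events" for i
      by (auto simp: F_def)
  next
    fix A J assume J: "J \<noteq> {}" "J \<subseteq> I" "finite J" "\<forall>j\<in>J. A j \<in> F j"
    then have "\<forall>j\<in>J. \<exists>a. A j = {x \<in> space M. a < S j x}"
      by (auto simp: F_def)
    then obtain a where a: "\<And>j. j \<in> J \<Longrightarrow> A j = {x \<in> space M. a j < S j x}"
      by metis
    have "prob (\<Inter>j\<in>J. A j) = (\<Prod>j\<in>J. exp (- q j * max 0 (a j)))"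
      using marg[OF J(2,1), of a] a by simp
    also have "\<dots> = (\<Prod>j\<in>J. prob (A j))"
      using J by (intro prod.cong) (auto simp: a marg1)
    finally show "prob (\<Inter>j\<in>J. A j) = (\<Prod>j\<in>J. prob (A j))" .
  qed
  moreover have "Int_stable (F i)" for i
  proof (rule Int_stableI)
    fix A B assume "A \<in> F i" "B \<in> F i"
    then obtain a b where "A = {x \<in> space M. a < S i x}" "B = {x \<in> space M. b < S i x}"
      by (auto simp: F_def)
    then have "A \<inter> B = {x \<in> space M. max a b < S i x}" by auto
    then show "A \<inter> B \<in> F i" unfolding F_def by blast
  qed
  ultimately have indep: "indep_sets (\<lambda>i. sigma_sets (space M) (F i)) I"
    by (intro indep_sets_sigma)
  have sub: "{S i -` A \<inter> space M | A. A \<in> sets borel} \<subseteq> sigma_sets (space M) (F i)" for i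
  proof -
    have F: "F i \<subseteq> Pow (space M)" by (auto simp: F_def)
    have "S i \<in> borel_measurable (sigma (space M) (F i))"
      using F by (subst borel_measurable_iff_greater) (auto simp: space_measure_of_conv F_def)
    then show ?thesis
      using F by (auto dest: measurable_sets simp: space_measure_of_conv)
  qed
  show "indep_vars (\<lambda>_. borel) S I"
    unfolding indep_vars_def2
    using indep_sets_mono_sets[OF indep] sub by auto
qed

text \<open>Isolates the law of \<open>Y\<close> and \<open>S\<close> from the process
  \<open>X\<close> built on them; the sign conditions on \<open>Q\<close> provide genuine
  exponential laws and nonnegative path weights.\<close>

locale jump_chain_holding_times = prob_space P
  for P :: "'w measure" +
  fixes Q :: "'e::countable \<Rightarrow> 'e \<Rightarrow> real" and k :: 'e
    and Y :: "nat \<Rightarrow> 'w \<Rightarrow> 'e" and S :: "nat \<Rightarrow> 'w \<Rightarrow> real"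
  assumes Y_measurable [measurable]: "\<And>n. Y n \<in> measurable P (count_space UNIV)"
    and S_measurable [measurable]: "\<And>n. S n \<in> borel_measurable P"
    and S_pos: "\<And>n \<omega>. \<omega> \<in> space P \<Longrightarrow> 0 < S n \<omega>"
    and exit_rate_pos: "\<And>i. 0 < exit_rate Q i"
    and jump_prob_nonneg: "\<And>i j. 0 \<le> jump_prob Q i j"
    and joint_law: "\<And>n y t. (\<forall>l\<le>n. 0 \<le> t l) \<Longrightarrow>
      prob {\<omega> \<in> space P. \<forall>l\<le>n. Y l \<omega> = y l \<and> t l < S l \<omega>} =
        (if y 0 = k then 1 else 0) * (\<Prod>l<n. jump_prob Q (y l) (y (Suc l)))
          * (\<Prod>l\<le>n. exp (- exit_rate Q (y l) * t l))"
begin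

definition path_prob :: "nat \<Rightarrow> (nat \<Rightarrow> 'e) \<Rightarrow> real" where
  "path_prob n y = (if y 0 = k then 1 else 0) * (\<Prod>l<n. jump_prob Q (y l) (y (Suc l)))"

lemma path_prob_nonneg: "0 \<le> path_prob n y"
  by (simp add: path_prob_def prod_nonneg jump_prob_nonneg)

lemma prob_path: "prob {\<omega> \<in> space P. \<forall>l\<le>n. Y l \<omega> = y l} = path_prob n y"
proof -
  have "{\<omega> \<in> space P. \<forall>l\<le>n. Y l \<omega> = y l} = {\<omega> \<in> space P. \<forall>l\<le>n. Y l \<omega> = y l \<and> 0 < S l \<omega>}"
    using S_pos by auto
  then show ?thesis
    using joint_law[of n "\<lambda>_. 0" y] by (simp add: path_prob_def)
qed

text \<open>Conditioned on the event that \<open>Y\<close> follows \<open>y\<close>, the joint law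
  says that the holding times are independent exponentials, so the expectation is a product. If the
  path has probability 0, both sides vanish.\<close>

lemma nn_integral_path:
  fixes g :: "nat \<Rightarrow> real \<Rightarrow> ennreal"
  assumes g [measurable]: "\<And>l. g l \<in> borel_measurable borel"
  shows "(\<integral>\<^sup>+\<omega>. (\<Prod>l\<le>n. indicator {y l} (Y l \<omega>) * g l (S l \<omega>)) \<partial>P) =
    ennreal (path_prob n y)
      * (\<Prod>l\<le>n. \<integral>\<^sup>+s. ennreal (exponential_density (exit_rate Q (y l)) s) * g l s \<partial>lborel)"
proof -
  define A where "A = {\<omega> \<in> space P. \<forall>l\<le>n. Y l \<omega> = y l}"
  have A [measurable]: "A \<in> events"
    unfolding A_def by measurable
  have prob_A: "emeasure P A = ennreal (path_prob n y)"
    by (simp add: A_def emeasure_eq_measure prob_path)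
  have ind: "(\<Prod>l\<le>n. indicator {y l} (Y l \<omega>) * g l (S l \<omega>)) = (\<Prod>l\<le>n. g l (S l \<omega>)) * indicator A \<omega>"
    if \<omega>: "\<omega> \<in> space P" for \<omega>
  proof (cases "\<omega> \<in> A")
    case True
    then show ?thesis by (auto simp: A_def)
  next
    case False
    then obtain l where "l \<le> n" "Y l \<omega> \<noteq> y l"
      using \<omega> by (auto simp: A_def)
    then have "(\<Prod>l\<le>n. indicator {y l} (Y l \<omega>) * g l (S l \<omega>)) = 0"
      by (intro prod_zero) (auto intro!: bexI[of _ l])
    with False show ?thesis by simp
  qed
  have "(\<integral>\<^sup>+\<omega>. (\<Prod>l\<le>n. indicator {y l} (Y l \<omega>) * g l (S l \<omega>)) \<partial>P) =
      (\<integral>\<^sup>+\<omega>. (\<Prod>l\<le>n. g l (S l \<omega>)) * indicator A \<omega> \<partial>P)"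
    by (intro nn_integral_cong ind)
  also have "\<dots> = ennreal (path_prob n y)
      * (\<Prod>l\<le>n. \<integral>\<^sup>+s. ennreal (exponential_density (exit_rate Q (y l)) s) * g l s \<partial>lborel)"
  proof (cases "path_prob n y = 0")
    case True
    then have "A \<in> null_sets P"
      using prob_A by auto
    then have "(\<integral>\<^sup>+\<omega>. (\<Prod>l\<le>n. g l (S l \<omega>)) * indicator A \<omega> \<partial>P) = 0"
      by (rule nn_integral_null_set)
    then show ?thesis using True by simp
  next
    case False
    define U where "U = uniform_measure P A"
    have pos: "0 < path_prob n y" using False path_prob_nonneg[of n y] by simp
    interpret U: prob_space U
      unfolding U_def using prob_A pos by (intro prob_space_uniform_measure) auto
    have space_U [simp]: "space U = space P" and sets_U [measurable_cong, simp]: "sets U = sets P"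
      by (simp_all add: U_def)
    have S_U: "S l \<in> borel_measurable U" for l
      by measurable
    have joint: "U.prob {\<omega> \<in> space U. \<forall>l\<in>{..n}. t l < S l \<omega>} = (\<Prod>l\<in>{..n}. exp (- exit_rate Q (y l) * t l))"
      if t: "\<forall>l\<in>{..n}. 0 \<le> t l" for t
    proof -
      have "U.prob {\<omega> \<in> space U. \<forall>l\<in>{..n}. t l < S l \<omega>} =
          prob (A \<inter> {\<omega> \<in> space P. \<forall>l\<in>{..n}. t l < S l \<omega>}) / prob A"
        unfolding U_def using prob_A pos by (subst measure_uniform_measure) (auto simp: U_def)
      also have "A \<inter> {\<omega> \<in> space P. \<forall>l\<in>{..n}. t l < S l \<omega>} =
          {\<omega> \<in> space P. \<forall>l\<le>n. Y l \<omega> = y l \<and> t l < S l \<omega>}"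
        by (auto simp: A_def)
      also have "prob \<dots> / prob A = (\<Prod>l\<in>{..n}. exp (- exit_rate Q (y l) * t l))"
        using joint_law[of n t y] t pos prob_path[of n y]
        by (simp add: A_def path_prob_def[symmetric])
      finally show ?thesis .
    qed
    note exps = U.exponential_jointD[OF finite_atMost S_U exit_rate_pos joint]
    have "(\<integral>\<^sup>+\<omega>. (\<Prod>l\<le>n. g l (S l \<omega>)) * indicator A \<omega> \<partial>P) =
        ennreal (path_prob n y) * (\<integral>\<^sup>+\<omega>. (\<Prod>l\<le>n. g l (S l \<omega>)) \<partial>U)"
      unfolding U_def using pos prob_A
      by (subst nn_integral_uniform_measure) (auto simp: ennreal_times_divide mult.commute[of "ennreal _"] ennreal_mult_divide_eq)
    also have "(\<integral>\<^sup>+\<omega>. (\<Prod>l\<le>n. g l (S l \<omega>)) \<partial>U) = (\<Prod>l\<le>n. \<integral>\<^sup>+\<omega>. g l (S l \<omega>) \<partial>U)"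
      by (intro U.indep_vars_nn_integral U.indep_vars_compose2[OF exps(1)]) auto
    also have "\<dots> = (\<Prod>l\<le>n. \<integral>\<^sup>+s. ennreal (exponential_density (exit_rate Q (y l)) s) * g l s \<partial>lborel)"
      by (intro prod.cong refl distributed_nn_integral[symmetric] exps(2)) auto
    finally show ?thesis .
  qed
  finally show ?thesis .
qed

text \<open>The integrand is a product along the path: \<open>g\<close> for completed sojourns,
  \<open>h\<close> for the one in progress, 0 after a return to \<open>k\<close>. By the hypothesis
  on \<open>A\<close>, a completed sojourn with its jump is on average a matrix entry, so summing
  over the paths builds up \<open>taboo_pow\<close>.\<close>

lemma nn_integral_taboo:
  fixes g h :: "'e \<Rightarrow> real \<Rightarrow> ennreal" and A :: "'e \<Rightarrow> 'e \<Rightarrow> real"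
  assumes g [measurable]: "\<And>i. g i \<in> borel_measurable borel"
    and h [measurable]: "\<And>i. h i \<in> borel_measurable borel"
    and A: "\<And>i j. ennreal (jump_prob Q i j)
      * (\<integral>\<^sup>+s. ennreal (exponential_density (exit_rate Q i) s) * g i s \<partial>lborel) = ennreal (A i j)"
  shows "(\<integral>\<^sup>+\<omega>. (\<Prod>l<n. if 0 < l \<and> Y l \<omega> = k then 0 else g (Y l \<omega>) (S l \<omega>))
      * (indicator {i} (Y n \<omega>) * (if 0 < n \<and> i = k then 0 else h i (S n \<omega>))) \<partial>P) =
    taboo_pow A k n i
      * (\<integral>\<^sup>+s. ennreal (exponential_density (exit_rate Q i) s) * h i s \<partial>lborel)"
proof -
  define H where
    "H i = (\<integral>\<^sup>+s. ennreal (exponential_density (exit_rate Q i) s) * h i s \<partial>lborel)" for i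
  define b where "b l i s = (if 0 < l \<and> i = k then 0 else g i s)" for l :: nat and i s
  define c where "c l i s = (if l = n then h i s else g i s)" for l i s
  \<comment> \<open>Interpolates between a prescribed path and the random one: before time
    \<open>m\<close> the actual state is used, with the taboo built into \<open>b\<close>; from
    \<open>m\<close> on, the states are forced to agree with \<open>y\<close>.\<close>
  define F where "F m y l \<omega> =
    (if l < m then b l (Y l \<omega>) (S l \<omega>) else indicator {y l} (Y l \<omega>) * c l (y l) (S l \<omega>))" for m y l \<omega>
  have b_meas [measurable]: "b l i \<in> borel_measurable borel"
    and c_meas [measurable]: "c l i \<in> borel_measurable borel" for l i
    unfolding b_def c_def by measurable
  have [measurable]: "(\<lambda>\<omega>. F m y l \<omega>) \<in> borel_measurable P" for m y l
    unfolding F_def by measurable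
  \<comment> \<open>The joint law is known for prescribed states only, so the indicators of the states before
    time \<open>n\<close> are summed out one at a time, in increasing order of time.\<close>
  have claim: "(\<integral>\<^sup>+\<omega>. (\<Prod>l\<le>n. F m y l \<omega>) \<partial>P) =
      taboo_pow A k m (y m) * (\<Prod>l=m..<n. ennreal (A (y l) (y (Suc l)))) * H (y n)"
    if "m \<le> n" "m = 0 \<or> y m \<noteq> k" for m y
    using that
  proof (induction m arbitrary: y)
    case 0
    have "(\<integral>\<^sup>+\<omega>. (\<Prod>l\<le>n. F 0 y l \<omega>) \<partial>P) =
      (\<integral>\<^sup>+\<omega>. (\<Prod>l\<le>n. indicator {y l} (Y l \<omega>) * c l (y l) (S l \<omega>)) \<partial>P)"
      by (simp add: F_def)
    also have "\<dots> = ennreal (path_prob n y)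
      * (\<Prod>l\<le>n. \<integral>\<^sup>+s. ennreal (exponential_density (exit_rate Q (y l)) s) * c l (y l) s \<partial>lborel)"
      by (rule nn_integral_path) measurable
    also have "(\<Prod>l\<le>n. \<integral>\<^sup>+s. ennreal (exponential_density (exit_rate Q (y l)) s) * c l (y l) s \<partial>lborel) =
      (\<Prod>l<n. \<integral>\<^sup>+s. ennreal (exponential_density (exit_rate Q (y l)) s) * g (y l) s \<partial>lborel) * H (y n)"
      by (simp add: lessThan_Suc_atMost[symmetric] c_def H_def)
    also have "ennreal (path_prob n y) =
        (if y 0 = k then 1 else 0) * (\<Prod>l<n. ennreal (jump_prob Q (y l) (y (Suc l))))"
      by (simp add: path_prob_def prod_ennreal jump_prob_nonneg)
    finally show ?case
      by (simp add: A[symmetric] prod.distrib lessThan_atLeast0[symmetric] mult.assoc)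
  next
    case (Suc m)
    then have m: "m < n" and ym: "y (Suc m) \<noteq> k" by auto
    \<comment> \<open>Only \<open>x = Y m \<omega>\<close> contributes to the sum. The value
      \<open>k\<close> is cut out for \<open>0 < m\<close> because the induction hypothesis requires
      \<open>y m\<close> to differ from \<open>k\<close> there.\<close>
    have decomp: "(\<Prod>l\<le>n. F (Suc m) y l \<omega>) =
      (\<integral>\<^sup>+x. (if 0 < m \<and> x = k then 0 else \<Prod>l\<le>n. F m (y(m := x)) l \<omega>) \<partial>count_space UNIV)" for \<omega>
    proof -
      have split: "(\<Prod>l\<le>n. F m' y' l \<omega>) = F m' y' m \<omega> * (\<Prod>l\<in>{..n}-{m}. F m' y' l \<omega>)" for m' y'
        using m by (intro prod.remove) auto
      have rest: "(\<Prod>l\<in>{..n}-{m}. F m (y(m := x)) l \<omega>) = (\<Prod>l\<in>{..n}-{m}. F (Suc m) y l \<omega>)" for x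
        by (intro prod.cong) (auto simp: F_def less_Suc_eq)
      have "(if 0 < m \<and> x = k then 0 else \<Prod>l\<le>n. F m (y(m := x)) l \<omega>) =
          (\<Prod>l\<le>n. F (Suc m) y l \<omega>) * indicator {Y m \<omega>} x" for x
        unfolding split rest using m by (auto simp: F_def b_def c_def indicator_def)
      then show ?thesis
        by (simp add: nn_integral_cmult_indicator)
    qed
    have "(\<integral>\<^sup>+\<omega>. (\<Prod>l\<le>n. F (Suc m) y l \<omega>) \<partial>P) =
      (\<integral>\<^sup>+x. (\<integral>\<^sup>+\<omega>. (if 0 < m \<and> x = k then 0 else \<Prod>l\<le>n. F m (y(m := x)) l \<omega>) \<partial>P) \<partial>count_space UNIV)"
      unfolding decomp by (subst nn_integral_count_space_nn_integral) auto
    also have "\<dots> = (\<integral>\<^sup>+x. taboo_pow A k m x * ennreal (A x (y (Suc m)))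
        * ((\<Prod>l=Suc m..<n. ennreal (A (y l) (y (Suc l)))) * H (y n)) \<partial>count_space UNIV)"
    proof (rule nn_integral_cong)
      fix x
      show "(\<integral>\<^sup>+\<omega>. (if 0 < m \<and> x = k then 0 else \<Prod>l\<le>n. F m (y(m := x)) l \<omega>) \<partial>P) =
        taboo_pow A k m x * ennreal (A x (y (Suc m)))
        * ((\<Prod>l=Suc m..<n. ennreal (A (y l) (y (Suc l)))) * H (y n))"
      proof (cases "0 < m \<and> x = k")
        case True
        then show ?thesis by (cases m) auto
      next
        case False
        define z where "z = y(m := x)"
        have z: "z m = x" "\<And>l. l \<noteq> m \<Longrightarrow> z l = y l"
          by (auto simp: z_def)
        have "(\<Prod>l=Suc m..<n. ennreal (A (z l) (z (Suc l)))) =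
            (\<Prod>l=Suc m..<n. ennreal (A (y l) (y (Suc l))))"
          by (intro prod.cong) (auto simp: z)
        then have "(\<integral>\<^sup>+\<omega>. (\<Prod>l\<le>n. F m z l \<omega>) \<partial>P) = taboo_pow A k m x * ennreal (A x (y (Suc m)))
            * ((\<Prod>l=Suc m..<n. ennreal (A (y l) (y (Suc l)))) * H (y n))"
          using Suc.IH[of z] m False
          by (auto simp: prod.atLeast_Suc_lessThan mult.assoc z simp del: taboo_pow.simps)
        with False show ?thesis
          by (cases "m = 0") (simp_all add: z_def)
      qed
    qed
    also have "\<dots> = taboo_pow A k (Suc m) (y (Suc m))
        * (\<Prod>l=Suc m..<n. ennreal (A (y l) (y (Suc l)))) * H (y n)"
      using ym by (subst nn_integral_multc) (auto simp: mult.assoc)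
    finally show ?case .
  qed
  show ?thesis
  proof (cases "0 < n \<and> i = k")
    case True
    then show ?thesis by (cases n) auto
  next
    case False
    have "(\<Prod>l<n. if 0 < l \<and> Y l \<omega> = k then 0 else g (Y l \<omega>) (S l \<omega>))
        * (indicator {i} (Y n \<omega>) * (if 0 < n \<and> i = k then 0 else h i (S n \<omega>))) = (\<Prod>l\<le>n. F n (\<lambda>_. i) l \<omega>)" for \<omega>
      using False by (auto simp: lessThan_Suc_atMost[symmetric] F_def b_def c_def)
    with claim[of n "\<lambda>_. i"] False show ?thesis
      by (simp add: H_def)
  qed
qed

end

section \<open>Integrals along a single path\<close>

text \<open>A single trajectory with no probability involved. Without \<open>y_Suc_neq\<close> the
  end of the first sojourn need not be visible in \<open>X\<close>, and the first jump time could
  exceed \<open>s 0\<close>.\<close>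

locale jump_path =
  fixes X :: "real \<Rightarrow> 'w \<Rightarrow> 'e option" and \<omega> :: 'w and y :: "nat \<Rightarrow> 'e" and s :: "nat \<Rightarrow> real"
  assumes s_pos: "\<And>n. 0 < s n"
    and y_Suc_neq: "\<And>n. y (Suc n) \<noteq> y n"
    and X_alive: "\<And>n t. (\<Sum>l<n. s l) \<le> t \<Longrightarrow> t < (\<Sum>l<Suc n. s l) \<Longrightarrow> X t \<omega> = Some (y n)"
    and X_exploded: "\<And>t. (\<And>n. (\<Sum>l<n. s l) \<le> t) \<Longrightarrow> X t \<omega> = None"
begin

definition T :: "nat \<Rightarrow> real" where "T n = (\<Sum>l<n. s l)"

lemma T_0 [simp]: "T 0 = 0" and T_Suc: "T (Suc n) = T n + s n"
  by (simp_all add: T_def)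

lemma T_mono: "m \<le> n \<Longrightarrow> T m \<le> T n"
  unfolding T_def by (intro sum_mono2) (auto intro: less_imp_le s_pos)

lemma T_nonneg: "0 \<le> T n"
  using T_mono[of 0 n] by simp

lemma X_eq: "T n \<le> t \<Longrightarrow> t < T (Suc n) \<Longrightarrow> X t \<omega> = Some (y n)"
  using X_alive[of n t] by (simp add: T_def)

lemma jump_index_unique:
  assumes "T m \<le> t" "t < T (Suc m)" "T n \<le> t" "t < T (Suc n)"
  shows "m = n"
  using T_mono[of "Suc m" n] T_mono[of "Suc n" m] assms by (cases m n rule: linorder_cases) auto

lemma jump_index_exists:
  assumes "0 \<le> t" "t < T N"
  obtains n where "n < N" "T n \<le> t" "t < T (Suc n)"
proof -
  define M where "M = (LEAST n. t < T n)"
  have M: "t < T M" and "M \<le> N"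
    unfolding M_def using assms by (auto intro: LeastI Least_le)
  have "M \<noteq> 0"
    using M assms by (auto intro: gr0I)
  then obtain n where n: "M = Suc n"
    by (cases M) auto
  then have "\<not> t < T n"
    unfolding M_def by (metis lessI not_less_Least)
  with M \<open>M \<le> N\<close> n show ?thesis
    by (intro that[of n]) auto
qed

lemma X_SomeD:
  assumes "0 \<le> t" "X t \<omega> = Some i"
  obtains n where "T n \<le> t" "t < T (Suc n)" "y n = i"
proof -
  have "\<not> (\<forall>n. (\<Sum>l<n. s l) \<le> t)"
    using X_exploded[of t] assms(2) by (metis option.distinct(1))
  then obtain N where "t < T N"
    by (auto simp: T_def not_le)
  then obtain n where "T n \<le> t" "t < T (Suc n)"
    using jump_index_exists assms by blast
  with assms show ?thesis
    by (intro that[of n]) (auto simp: X_eq)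
qed

lemma first_jump_time_eq: "first_jump_time X \<omega> = ereal (s 0)"
  unfolding first_jump_time_def
proof (rule Inf_eqI)
  have X0: "X 0 \<omega> = Some (y 0)"
    using s_pos[of 0] by (intro X_eq) (simp_all add: T_Suc)
  show "ereal (s 0) \<le> z" if "z \<in> {ereal t | t. 0 < t \<and> X t \<omega> \<noteq> X 0 \<omega>}" for z
  proof -
    from that obtain t where t: "z = ereal t" "0 < t" "X t \<omega> \<noteq> X 0 \<omega>" by auto
    then have "\<not> t < s 0"
      using X_eq[of 0 t] X0 by (auto simp: T_Suc)
    with t show ?thesis by simp
  qed
  have "X (s 0) \<omega> = Some (y 1)"
    using s_pos[of 1] by (intro X_eq) (simp_all add: T_Suc)
  then have "ereal (s 0) \<in> {ereal t | t. 0 < t \<and> X t \<omega> \<noteq> X 0 \<omega>}"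
    using X0 y_Suc_neq[of 0] s_pos[of 0] by auto
  then show "z \<le> ereal (s 0)"
    if "\<And>w. w \<in> {ereal t | t. 0 < t \<and> X t \<omega> \<noteq> X 0 \<omega>} \<Longrightarrow> z \<le> w" for z
    using that by blast
qed

text \<open>A visit to \<open>k\<close> at a time from \<open>s 0\<close> on lies in a sojourn of
  index at least 1, and that sojourn already starts in \<open>k\<close>. Hence only the states
  entered up to time \<open>t\<close> matter.\<close>

lemma less_return_time_iff:
  assumes "T n \<le> t" "t < T (Suc n)"
  shows "ereal t < return_time X k \<omega> \<longleftrightarrow> (\<forall>l\<in>{1..n}. y l \<noteq> k)"
proof
  assume less: "ereal t < return_time X k \<omega>"
  show "\<forall>l\<in>{1..n}. y l \<noteq> k"
  proof (rule ballI, rule notI)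
    fix l assume l: "l \<in> {1..n}" "y l = k"
    have "s 0 \<le> T l"
      using T_mono[of 1 l] l by (simp add: T_Suc)
    moreover have "X (T l) \<omega> = Some k"
      using X_eq[of l "T l"] l s_pos[of l] by (simp add: T_Suc)
    ultimately have "return_time X k \<omega> \<le> ereal (T l)"
      unfolding return_time_def first_jump_time_eq by (intro Inf_lower) auto
    also have "\<dots> \<le> ereal t"
      using T_mono[of l n] l assms by auto
    finally show False using less by simp
  qed
next
  assume avoid: "\<forall>l\<in>{1..n}. y l \<noteq> k"
  have "ereal (T (Suc n)) \<le> return_time X k \<omega>"
    unfolding return_time_def first_jump_time_eq
  proof (rule Inf_greatest)
    fix z assume "z \<in> {ereal t |t. ereal (s 0) \<le> ereal t \<and> X t \<omega> = Some k}"
    then obtain r where r: "z = ereal r" "s 0 \<le> r" "X r \<omega> = Some k" by auto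
    have "0 \<le> r" using r s_pos[of 0] by simp
    then obtain l where l: "T l \<le> r" "r < T (Suc l)" "y l = k"
      using X_SomeD r by blast
    have "l \<noteq> 0"
      using l r by (intro notI) (simp add: T_Suc)
    with avoid l have "n < l"
      by (intro not_le_imp_less) auto
    then show "ereal (T (Suc n)) \<le> z"
      using T_mono[of "Suc n" l] l r by simp
  qed
  with assms show "ereal t < return_time X k \<omega>"
    by (auto intro: less_le_trans[of _ "ereal (T (Suc n))"])
qed

lemma path_integral_eq:
  assumes t: "T n \<le> t" "t < T (Suc n)"
  shows "path_integral f X t \<omega> = (\<Sum>l<n. f (y l) * s l) + f (y n) * (t - T n)"
proof -
  \<comment> \<open>Up to \<open>t\<close> the path is a step function with finitely many steps:
    half-open intervals for the completed sojourns, and a closed one for the current sojourn, to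
    include \<open>t\<close> itself.\<close>
  have ind: "indicator {0..t} r *\<^sub>R (case X r \<omega> of None \<Rightarrow> 0 | Some j \<Rightarrow> f j) =
      (\<Sum>l<n. indicator {T l..<T (Suc l)} r *\<^sub>R f (y l)) + indicator {T n..t} r *\<^sub>R f (y n)" for r
  proof (cases "r \<in> {0..t}")
    case True
    then obtain l0 where l0: "T l0 \<le> r" "r < T (Suc l0)" "l0 \<le> n"
      using t by (metis atLeastAtMost_iff jump_index_exists le_less_trans less_Suc_eq_le)
    have "(\<Sum>l<n. indicator {T l..<T (Suc l)} r *\<^sub>R f (y l)) = (\<Sum>l<n. if l = l0 then f (y l0) else 0)"
      using l0 by (intro sum.cong) (auto simp: indicator_def dest: jump_index_unique[OF l0(1,2)])
    also have "\<dots> = (if l0 < n then f (y l0) else 0)"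
      by simp
    finally have "(\<Sum>l<n. indicator {T l..<T (Suc l)} r *\<^sub>R f (y l)) = (if l0 < n then f (y l0) else 0)" .
    moreover have "r \<in> {T n..t} \<longleftrightarrow> l0 = n"
      using jump_index_unique[OF l0(1,2), of n] l0 t True by auto
    ultimately show ?thesis
      using True l0 X_eq[OF l0(1,2)] by (auto simp: indicator_def)
  next
    case False
    have "(\<Sum>l<n. indicator {T l..<T (Suc l)} r *\<^sub>R f (y l)) = (\<Sum>l<n. 0)"
    proof (intro sum.cong refl)
      fix l assume "l \<in> {..<n}"
      then have "r \<notin> {T l..<T (Suc l)}"
        using False T_mono[of "Suc l" n] T_nonneg[of l] t by auto
      then show "indicator {T l..<T (Suc l)} r *\<^sub>R f (y l) = 0" by simp
    qed
    with False t T_nonneg[of n] show ?thesis by (auto simp: indicator_def)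
  qed
  have int: "integrable lborel (indicator {T l..<T (Suc l)} :: real \<Rightarrow> real)"
      "integrable lborel (indicator {T n..t} :: real \<Rightarrow> real)" for l
    using t T_mono[of l "Suc l"] by (auto intro!: integrable_real_indicator)
  have "path_integral f X t \<omega> = (LINT r|lborel. (\<Sum>l<n. indicator {T l..<T (Suc l)} r *\<^sub>R f (y l))
      + indicator {T n..t} r *\<^sub>R f (y n))"
    unfolding path_integral_def set_lebesgue_integral_def ind ..
  also have "\<dots> = (LINT r|lborel. (\<Sum>l<n. indicator {T l..<T (Suc l)} r *\<^sub>R f (y l)))
      + (LINT r|lborel. indicator {T n..t} r *\<^sub>R f (y n))"
    by (intro Bochner_Integration.integral_add Bochner_Integration.integrable_sum integrable_scaleR_left int)
  also have "(LINT r|lborel. (\<Sum>l<n. indicator {T l..<T (Suc l)} r *\<^sub>R f (y l))) =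
      (\<Sum>l<n. LINT r|lborel. indicator {T l..<T (Suc l)} r *\<^sub>R f (y l))"
    by (intro Bochner_Integration.integral_sum integrable_scaleR_left int)
  also have "\<dots> = (\<Sum>l<n. s l * f (y l))"
  proof (intro sum.cong refl)
    fix l
    show "(LINT r|lborel. indicator {T l..<T (Suc l)} r *\<^sub>R f (y l)) = s l * f (y l)"
      using s_pos[of l]
      by (subst integral_scaleR_left[OF int(1)]) (simp add: T_Suc)
  qed
  also have "(LINT r|lborel. indicator {T n..t} r *\<^sub>R f (y n)) = (t - T n) * f (y n)"
    using t by (subst integral_scaleR_left[OF int(2)]) simp
  finally show ?thesis by (simp add: mult.commute)
qed

text \<open>The half-line is cut at the jump times; after an explosion \<open>X\<close> is
  \<open>None\<close> and the integrand is 0. Writing \<open>t\<close> as the sum of the completed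
  holding times and the elapsed part of the current one distributes the discount \<open>c\<close>
  over the sojourns.\<close>

lemma nn_integral_until_return:
  "(\<integral>\<^sup>+t\<in>{0..}. ennreal (exp (- c * t + path_integral f X t \<omega>))
      * indicator {t. X t \<omega> = Some i \<and> ereal t < return_time X k \<omega>} t \<partial>lborel) =
    (\<Sum>n. (\<Prod>l<n. if 0 < l \<and> y l = k then 0 else ennreal (exp ((f (y l) - c) * s l)))
      * (indicator {i} (y n) * (if 0 < n \<and> i = k then 0
          else \<integral>\<^sup>+r\<in>{0..<s n}. ennreal (exp ((f i - c) * r)) \<partial>lborel)))"
proof -
  define W where "W n = (\<Prod>l<n. if 0 < l \<and> y l = k then 0 else ennreal (exp ((f (y l) - c) * s l)))
      * (indicator {i} (y n) * (if 0 < n \<and> i = k then 0 else 1))" for n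
  define e where "e n t = W n * (ennreal (exp ((f i - c) * (t - T n))) * indicator {T n..<T (Suc n)} t)" for n t
  have W: "W n = (if y n = i \<and> (\<forall>l\<in>{1..n}. y l \<noteq> k) then ennreal (exp (\<Sum>l<n. (f (y l) - c) * s l)) else 0)" for n
  proof (cases "y n = i \<and> (\<forall>l\<in>{1..n}. y l \<noteq> k)")
    case True
    then have "(\<Prod>l<n. if 0 < l \<and> y l = k then 0 else ennreal (exp ((f (y l) - c) * s l))) =
        (\<Prod>l<n. ennreal (exp ((f (y l) - c) * s l)))"
      by (intro prod.cong) auto
    with True show ?thesis
      by (auto simp: W_def exp_sum prod_ennreal)
  next
    case False
    show ?thesis
    proof (cases "y n = i")
      case True
      with False obtain l where l: "1 \<le> l" "l \<le> n" "y l = k" by auto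
      show ?thesis
      proof (cases "l = n")
        case False
        with l have "(\<Prod>l<n. if 0 < l \<and> y l = k then 0 else ennreal (exp ((f (y l) - c) * s l))) = 0"
          by (intro prod_zero) (auto intro!: bexI[of _ l])
        with l show ?thesis by (auto simp: W_def)
      qed (use l True in \<open>auto simp: W_def\<close>)
    qed (simp add: W_def)
  qed
  have pointwise: "ennreal (exp (- c * t + path_integral f X t \<omega>))
      * indicator {t. X t \<omega> = Some i \<and> ereal t < return_time X k \<omega>} t * indicator {0..} t = (\<Sum>n. e n t)" for t
  proof (cases "\<exists>n. T n \<le> t \<and> t < T (Suc n)")
    case True
    then obtain n where n: "T n \<le> t" "t < T (Suc n)" by blast
    have "0 \<le> t" using n T_nonneg[of n] by simp
    have "(\<Sum>n. e n t) = (\<Sum>m\<in>{n}. e m t)"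
      using jump_index_unique[OF n] by (intro suminf_finite) (auto simp: e_def indicator_def)
    also have "\<dots> = (if y n = i \<and> (\<forall>l\<in>{1..n}. y l \<noteq> k) then
        ennreal (exp (\<Sum>l<n. (f (y l) - c) * s l)) * ennreal (exp ((f i - c) * (t - T n))) else 0)"
      using n by (simp add: e_def W)
    also have "ennreal (exp (\<Sum>l<n. (f (y l) - c) * s l)) * ennreal (exp ((f i - c) * (t - T n))) =
        ennreal (exp (- c * t + ((\<Sum>l<n. f (y l) * s l) + f i * (t - T n))))"
      by (simp add: ennreal_mult[symmetric] exp_add[symmetric] T_def algebra_simps sum_subtractf sum_distrib_left)
    finally show ?thesis
      using n \<open>0 \<le> t\<close> by (auto simp: path_integral_eq[OF n] X_eq[OF n] less_return_time_iff[OF n] indicator_def)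
  next
    case False
    then have "e n t = 0" for n
      by (auto simp: e_def indicator_def)
    moreover have "\<not> (0 \<le> t \<and> X t \<omega> = Some i)"
      using False X_SomeD by metis
    ultimately show ?thesis by (auto simp: indicator_def)
  qed
  have "(\<integral>\<^sup>+t. e n t \<partial>lborel) = W n * (\<integral>\<^sup>+r\<in>{0..<s n}. ennreal (exp ((f i - c) * r)) \<partial>lborel)" for n
  proof -
    have "(\<integral>\<^sup>+t. e n t \<partial>lborel) = W n *
        (\<integral>\<^sup>+t. ennreal (exp ((f i - c) * (t - T n))) * indicator {T n..<T (Suc n)} t \<partial>lborel)"
      unfolding e_def by (rule nn_integral_cmult) measurable
    also have "(\<integral>\<^sup>+t. ennreal (exp ((f i - c) * (t - T n))) * indicator {T n..<T (Suc n)} t \<partial>lborel) =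
        (\<integral>\<^sup>+r. ennreal (exp ((f i - c) * r)) * indicator {0..<s n} r \<partial>lborel)"
      \<comment> \<open>Translation by the starting time of the sojourn; here \<open>c\<close> is
        the scale of the substitution and not the discount.\<close>
      by (subst nn_integral_real_affine[where c = 1 and t = "T n"])
         (auto intro!: nn_integral_cong simp: indicator_def T_Suc)
    finally show ?thesis .
  qed
  note e_integral = this
  have W_step: "W n * (\<integral>\<^sup>+r\<in>{0..<s n}. ennreal (exp ((f i - c) * r)) \<partial>lborel) =
      (\<Prod>l<n. if 0 < l \<and> y l = k then 0 else ennreal (exp ((f (y l) - c) * s l)))
      * (indicator {i} (y n) * (if 0 < n \<and> i = k then 0
          else \<integral>\<^sup>+r\<in>{0..<s n}. ennreal (exp ((f i - c) * r)) \<partial>lborel))" for n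
    by (cases "0 < n \<and> i = k") (simp_all only: W_def if_True if_False mult.assoc mult_zero_right mult_zero_left mult_1_left simp_thms)
  have "(\<integral>\<^sup>+t. (\<Sum>n. e n t) \<partial>lborel) = (\<Sum>n. \<integral>\<^sup>+t. e n t \<partial>lborel)"
    unfolding e_def by (rule nn_integral_suminf) measurable
  then show ?thesis
    unfolding pointwise e_integral W_step .
qed

end

section \<open>Exponential integrals for one sojourn\<close>

lemma nn_integral_exp_atLeast:
  fixes b :: real
  assumes "0 < b"
  shows "(\<integral>\<^sup>+t. ennreal (exp (- b * t)) * indicator {a..} t \<partial>lborel) = ennreal (exp (- b * a) / b)"
proof -
  have "((\<lambda>t. - exp (- b * t) / b) \<longlongrightarrow> 0) at_top"
  proof -
    have "filterlim (\<lambda>t. - b * t) at_bot at_top"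
      using assms by (intro filterlim_tendsto_neg_mult_at_bot[OF tendsto_const _ filterlim_ident]) auto
    then have "((\<lambda>t. - exp (- b * t) / b) \<longlongrightarrow> - 0 / b) at_top"
      using assms by (intro tendsto_intros filterlim_compose[OF exp_at_bot]) auto
    then show ?thesis by simp
  qed
  then have "(\<integral>\<^sup>+t. ennreal (exp (- b * t)) * indicator {a..} t \<partial>lborel) = ennreal (0 - (- exp (- b * a) / b))"
    using assms by (intro nn_integral_FTC_atLeast) (auto intro!: derivative_eq_intros)
  then show ?thesis by simp
qed

lemma nn_integral_exponential_density_exp:
  assumes "0 < q" "c < q"
  shows "(\<integral>\<^sup>+s. ennreal (exponential_density q s) * ennreal (exp (c * s)) \<partial>lborel) = ennreal (q / (q - c))"
proof -
  have "(\<integral>\<^sup>+s. ennreal (exponential_density q s) * ennreal (exp (c * s)) \<partial>lborel) =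
      (\<integral>\<^sup>+s. ennreal q * (ennreal (exp (- (q - c) * s)) * indicator {0..} s) \<partial>lborel)"
    using assms by (intro nn_integral_cong)
      (auto simp: exponential_density_def indicator_def ennreal_mult[symmetric] exp_add[symmetric] algebra_simps)
  also have "\<dots> = ennreal q * ennreal (1 / (q - c))"
    using nn_integral_exp_atLeast[of "q - c" 0] assms by (subst nn_integral_cmult) auto
  finally show ?thesis
    using assms by (simp add: ennreal_mult[symmetric])
qed

text \<open>After exchanging the integrals, the inner one is the probability
  \<open>exp (- q * r)\<close> that the sojourn outlasts \<open>r\<close>; what remains is the
  integral of \<open>exp (- (q - c) * r)\<close>.\<close>

lemma nn_integral_exponential_density_occupation:
  assumes "0 < q" "c < q"
  shows "(\<integral>\<^sup>+s. ennreal (exponential_density q s)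
      * (\<integral>\<^sup>+r\<in>{0..<s}. ennreal (exp (c * r)) \<partial>lborel) \<partial>lborel) = ennreal (1 / (q - c))"
proof -
  have tail: "(\<integral>\<^sup>+s. ennreal (exponential_density q s) * (if 0 \<le> r \<and> r < s then 1 else 0) \<partial>lborel) =
      ennreal (exp (- q * r)) * indicator {0..} r" for r
  proof (cases "0 \<le> r")
    case True
    \<comment> \<open>The strict condition \<open>r < s\<close> and the indicator of
      \<open>{r..}\<close> differ only at this point.\<close>
    have "AE s in lborel. s \<noteq> r"
      by (rule AE_lborel_singleton)
    then have "(\<integral>\<^sup>+s. ennreal (exponential_density q s) * (if 0 \<le> r \<and> r < s then 1 else 0) \<partial>lborel) =
        (\<integral>\<^sup>+s. ennreal q * (ennreal (exp (- q * s)) * indicator {r..} s) \<partial>lborel)"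
      using True assms by (intro nn_integral_cong_AE, elim AE_mp, intro AE_I2)
        (auto simp: exponential_density_def indicator_def ennreal_mult[symmetric] mult.commute)
    also have "\<dots> = ennreal q * ennreal (exp (- q * r) / q)"
      using nn_integral_exp_atLeast[of q r] assms by (subst nn_integral_cmult) auto
    finally show ?thesis
      using assms True by (simp add: ennreal_mult[symmetric])
  qed simp
  have "(\<integral>\<^sup>+s. ennreal (exponential_density q s) * (\<integral>\<^sup>+r\<in>{0..<s}. ennreal (exp (c * r)) \<partial>lborel) \<partial>lborel) =
      (\<integral>\<^sup>+s. (\<integral>\<^sup>+r. ennreal (exp (c * r)) * (ennreal (exponential_density q s) * (if 0 \<le> r \<and> r < s then 1 else 0))
        \<partial>lborel) \<partial>lborel)"
    by (subst nn_integral_cmult[symmetric]) (auto intro!: nn_integral_cong simp: indicator_def mult.commute)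
  also have "\<dots> = (\<integral>\<^sup>+r. (\<integral>\<^sup>+s. ennreal (exp (c * r)) * (ennreal (exponential_density q s) * (if 0 \<le> r \<and> r < s then 1 else 0))
        \<partial>lborel) \<partial>lborel)"
    by (rule lborel_pair.Fubini') measurable
  also have "\<dots> = (\<integral>\<^sup>+r. ennreal (exp (c * r)) * (ennreal (exp (- q * r)) * indicator {0..} r) \<partial>lborel)"
  proof (rule nn_integral_cong)
    fix r
    have "(\<integral>\<^sup>+s. ennreal (exp (c * r)) * (ennreal (exponential_density q s) * (if 0 \<le> r \<and> r < s then 1 else 0)) \<partial>lborel)
        = ennreal (exp (c * r)) * (\<integral>\<^sup>+s. ennreal (exponential_density q s) * (if 0 \<le> r \<and> r < s then 1 else 0) \<partial>lborel)"
      by (rule nn_integral_cmult) measurable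
    then show "(\<integral>\<^sup>+s. ennreal (exp (c * r)) * (ennreal (exponential_density q s) * (if 0 \<le> r \<and> r < s then 1 else 0)) \<partial>lborel)
        = ennreal (exp (c * r)) * (ennreal (exp (- q * r)) * indicator {0..} r)"
      unfolding tail .
  qed
  also have "\<dots> = (\<integral>\<^sup>+r. ennreal (exp (- (q - c) * r)) * indicator {0..} r \<partial>lborel)"
    by (intro nn_integral_cong)
       (auto simp: indicator_def ennreal_mult[symmetric] exp_add[symmetric] algebra_simps)
  also have "\<dots> = ennreal (1 / (q - c))"
    using nn_integral_exp_atLeast[of "q - c" 0] assms by simp
  finally show ?thesis .
qed

section \<open>Occupation until the first return\<close>

context jump_chain_holding_times
begin

text \<open>\<open>jump_prob\<close> is 0 on the diagonal, so each finite path with a repeated state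
  has probability 0. Taking the paths as extensional functions on \<open>{..Suc n}\<close> leaves
  only countably many of them.\<close>

lemma AE_Y_Suc_neq: "AE \<omega> in P. \<forall>n. Y (Suc n) \<omega> \<noteq> Y n \<omega>"
proof (subst AE_all_countable, rule allI)
  fix n
  define C where "C = {y \<in> PiE {..Suc n} (\<lambda>_. UNIV :: 'e set). y (Suc n) = y n}"
  have "countable (PiE {..Suc n} (\<lambda>_. UNIV :: 'e set))"
    by (intro countable_PiE) auto
  then have "countable C"
    by (rule countable_subset[rotated]) (auto simp: C_def)
  have "AE \<omega> in P. \<not> (\<forall>l\<le>Suc n. Y l \<omega> = y l)" if "y \<in> C" for y
  proof -
    have "path_prob (Suc n) y = 0"
      using that by (simp add: path_prob_def C_def jump_prob_def)
    then have "emeasure P {\<omega> \<in> space P. \<forall>l\<le>Suc n. Y l \<omega> = y l} = 0"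
      by (simp only: emeasure_eq_measure prob_path ennreal_0)
    then show ?thesis
      by (intro AE_I[where N = "{\<omega> \<in> space P. \<forall>l\<le>Suc n. Y l \<omega> = y l}"]) auto
  qed
  then have "AE \<omega> in P. \<forall>y\<in>C. \<not> (\<forall>l\<le>Suc n. Y l \<omega> = y l)"
    using \<open>countable C\<close> by (simp add: AE_ball_countable)
  then show "AE \<omega> in P. Y (Suc n) \<omega> \<noteq> Y n \<omega>"
  proof eventually_elim
    case (elim \<omega>)
    show ?case
    proof
      assume "Y (Suc n) \<omega> = Y n \<omega>"
      then have "restrict (\<lambda>l. Y l \<omega>) {..Suc n} \<in> C"
        by (auto simp: C_def)
      with elim show False by fastforce
    qed
  qed
qed

text \<open>Averages the pathwise decomposition by means of the joint law. The pathwise part applies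
  almost surely only, namely where consecutive states differ. The condition that
  \<open>f i - c\<close> stays below the exit rate makes the mean weight of a sojourn
  finite.\<close>

lemma nn_integral_until_return_eq_taboo:
  fixes X :: "real \<Rightarrow> 'w \<Rightarrow> 'e option" and f :: "'e \<Rightarrow> real"
  assumes X_alive: "\<And>\<omega> t n. \<omega> \<in> space P \<Longrightarrow> 0 \<le> t \<Longrightarrow> (\<Sum>l<n. S l \<omega>) \<le> t \<Longrightarrow> t < (\<Sum>l<Suc n. S l \<omega>) \<Longrightarrow>
      X t \<omega> = Some (Y n \<omega>)"
    and X_exploded: "\<And>\<omega> t. \<omega> \<in> space P \<Longrightarrow> 0 \<le> t \<Longrightarrow> (\<And>n. (\<Sum>l<n. S l \<omega>) \<le> t) \<Longrightarrow> X t \<omega> = None"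
    and c: "\<And>i. f i - c < exit_rate Q i"
    and A: "\<And>i j. A i j = jump_prob Q i j * (exit_rate Q i / (exit_rate Q i - (f i - c)))"
  shows "(\<integral>\<^sup>+\<omega>. (\<integral>\<^sup>+t\<in>{0..}. ennreal (exp (- c * t + path_integral f X t \<omega>))
      * indicator {t. X t \<omega> = Some i \<and> ereal t < return_time X k \<omega>} t \<partial>lborel) \<partial>P) =
    (\<Sum>n. taboo_pow A k n i) * ennreal (1 / (exit_rate Q i - (f i - c)))"
proof -
  define g where "g i s = ennreal (exp ((f i - c) * s))" for i s
  define h where "h i s = (\<integral>\<^sup>+r\<in>{0..<s}. ennreal (exp ((f i - c) * r)) \<partial>lborel)" for i s
  have g_meas [measurable]: "g i \<in> borel_measurable borel" for i
    unfolding g_def by measurable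
  \<comment> \<open>The domain of integration depends on \<open>s\<close>; moved into the integrand,
    it leaves a jointly measurable function.\<close>
  have "(\<lambda>s. \<integral>\<^sup>+r. ennreal (exp ((f i - c) * r)) * (if 0 \<le> r \<and> r < s then 1 else 0) \<partial>lborel)
      \<in> borel_measurable borel" for i
    by measurable
  moreover have "h i = (\<lambda>s. \<integral>\<^sup>+r. ennreal (exp ((f i - c) * r)) * (if 0 \<le> r \<and> r < s then 1 else 0) \<partial>lborel)" for i
    by (auto simp: h_def fun_eq_iff indicator_def intro!: nn_integral_cong)
  ultimately have h_meas [measurable]: "h i \<in> borel_measurable borel" for i
    by simp
  have A_eq: "ennreal (jump_prob Q i j)
      * (\<integral>\<^sup>+s. ennreal (exponential_density (exit_rate Q i) s) * g i s \<partial>lborel) = ennreal (A i j)" for i j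
    unfolding g_def A nn_integral_exponential_density_exp[OF exit_rate_pos c]
    by (rule ennreal_mult'[symmetric]) (rule jump_prob_nonneg)
  define W where "W n \<omega> = (\<Prod>l<n. if 0 < l \<and> Y l \<omega> = k then 0 else g (Y l \<omega>) (S l \<omega>))
      * (indicator {i} (Y n \<omega>) * (if 0 < n \<and> i = k then 0 else h i (S n \<omega>)))" for n \<omega>
  have W_meas [measurable]: "W n \<in> borel_measurable P" for n
    unfolding W_def by measurable
  have "AE \<omega> in P. (\<integral>\<^sup>+t\<in>{0..}. ennreal (exp (- c * t + path_integral f X t \<omega>))
      * indicator {t. X t \<omega> = Some i \<and> ereal t < return_time X k \<omega>} t \<partial>lborel) = (\<Sum>n. W n \<omega>)"
    using AE_Y_Suc_neq AE_space
  proof eventually_elim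
    case (elim \<omega>)
    have S_sum_nonneg: "0 \<le> (\<Sum>l<n. S l \<omega>)" for n
      using S_pos[OF elim(2)] by (intro sum_nonneg) (auto intro: less_imp_le)
    interpret jump_path X \<omega> "\<lambda>n. Y n \<omega>" "\<lambda>n. S n \<omega>"
    proof
      show "X t \<omega> = Some (Y n \<omega>)" if "(\<Sum>l<n. S l \<omega>) \<le> t" "t < (\<Sum>l<Suc n. S l \<omega>)" for n t
        using X_alive[OF elim(2) _ that] that S_sum_nonneg[of n] by linarith
      show "X t \<omega> = None" if "\<And>n. (\<Sum>l<n. S l \<omega>) \<le> t" for t
        using X_exploded[OF elim(2) _ that] that[of 0] by simp
    qed (use elim S_pos in auto)
    show ?case
      unfolding W_def g_def h_def by (rule nn_integral_until_return)
  qed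
  then have "(\<integral>\<^sup>+\<omega>. (\<integral>\<^sup>+t\<in>{0..}. ennreal (exp (- c * t + path_integral f X t \<omega>))
      * indicator {t. X t \<omega> = Some i \<and> ereal t < return_time X k \<omega>} t \<partial>lborel) \<partial>P) =
      (\<integral>\<^sup>+\<omega>. (\<Sum>n. W n \<omega>) \<partial>P)"
    by (rule nn_integral_cong_AE)
  also have "\<dots> = (\<Sum>n. \<integral>\<^sup>+\<omega>. W n \<omega> \<partial>P)"
    by (rule nn_integral_suminf) measurable
  also have "\<dots> = (\<Sum>n. taboo_pow A k n i * ennreal (1 / (exit_rate Q i - (f i - c))))"
  proof (rule suminf_cong)
    fix n
    have "(\<integral>\<^sup>+\<omega>. W n \<omega> \<partial>P) = taboo_pow A k n i
        * (\<integral>\<^sup>+s. ennreal (exponential_density (exit_rate Q i) s) * h i s \<partial>lborel)"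
      unfolding W_def by (rule nn_integral_taboo[OF g_meas h_meas A_eq])
    then show "(\<integral>\<^sup>+\<omega>. W n \<omega> \<partial>P) = taboo_pow A k n i * ennreal (1 / (exit_rate Q i - (f i - c)))"
      unfolding h_def nn_integral_exponential_density_occupation[OF exit_rate_pos c] .
  qed
  also have "\<dots> = (\<Sum>n. taboo_pow A k n i) * ennreal (1 / (exit_rate Q i - (f i - c)))"
    by simp
  finally show ?thesis .
qed

end

text \<open>The expectation defining \<open>u\<close> could a priori be infinite, hence its type
  \<open>ennreal\<close>. Finiteness belongs to the conclusion, since \<open>enn2real\<close> would
  send an infinite value to 0.\<close>

theorem theorem1p3:
  fixes m Mbar Q :: "'e::countable \<Rightarrow> 'e \<Rightarrow> real"
    and k a b :: 'e
    and ds :: "'e \<Rightarrow> real"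
    and d lam :: real
    and Rd :: ennreal
    and P :: "'w measure"
    and X :: "real \<Rightarrow> 'w \<Rightarrow> 'e option"
    and u :: "'e \<Rightarrow> ennreal"
  assumes two_elements: "\<exists>i j :: 'e. i \<noteq> j"
    and metzler: "metzler m"
    and irreducible: "irreducible_matrix m"
    and row_sums_finite: "\<And>i. (\<lambda>j. m i j) summable_on UNIV"
    and ds_eq: "\<And>i. ds i = (\<Sum>\<^sub>\<infinity>j. m i j)"
    and sup_finite: "bdd_above (range (\<lambda>i. m i i))"
    and d_eq: "d = (SUP i. m i i)"
    and Rd_eq: "Rd = convergence_parameter (\<lambda>i j. m i j + (if i = j then d else 0)) a b"
    and lam_eq: "lam = 1 / enn2real Rd - d"
    and Mbar_eq: "\<And>i j. Mbar i j = (if i = j then 0 else m i j / (lam - m i i))"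
    and recurrent: "recurrent_matrix Mbar"
    and Q_eq: "\<And>i j. Q i j = m i j - (if i = j then ds i else 0)"
    and process: "minimal_Q_process Q k P X"
    and u_eq: "\<And>i. u i =
      (\<integral>\<^sup>+\<omega>. (\<integral>\<^sup>+t\<in>{0..}.
          ennreal (exp (- lam * t + path_integral ds X t \<omega>))
            * indicator {t. X t \<omega> = Some i \<and> ereal t < return_time X k \<omega>} t \<partial>lborel) \<partial>P)"
  shows "(\<forall>i. u i < \<infinity>) \<and>
    (\<forall>j. ((\<lambda>i. enn2real (u i) * m i j) has_sum (lam * enn2real (u j))) UNIV)"
proof -
  have m_pos: "0 < m i j" if "i \<noteq> j" for i j
    using metzler that by (auto simp: metzler_def)
  \<comment> \<open>Equality is excluded too: division by zero gives 0, so row \<open>i\<close> of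
    \<open>Mbar\<close> would again have no positive entry.\<close>
  have lam_gt: "m i i < lam" for i
  proof -
    obtain j where "0 < Mbar i j"
      using recurrent_matrix_row_pos[OF recurrent] by blast
    then show ?thesis
      using m_pos[of i j] by (auto simp: Mbar_eq zero_less_divide_iff split: if_splits)
  qed
  have exit_rate: "exit_rate Q i = ds i - m i i" for i
    by (simp add: exit_rate_def Q_eq)
  have rate_pos: "0 < exit_rate Q i" for i
  proof -
    obtain j where j: "j \<noteq> i"
      using two_elements by metis
    \<comment> \<open>The diagonal entry may be negative, but the comparison requires signs only
      outside \<open>{i, j}\<close>.\<close>
    have "sum (m i) {i, j} \<le> ds i"
      unfolding ds_eq
      by (rule finite_sum_le_infsum) (use row_sums_finite m_pos in \<open>auto intro: less_imp_le\<close>)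
    then show ?thesis
      using j m_pos[of i j] by (simp add: exit_rate)
  qed
  obtain Y S where process_YS:
    "\<And>n. Y n \<in> measurable P (count_space UNIV)" "\<And>n. S n \<in> borel_measurable P"
    "\<And>n \<omega>. \<omega> \<in> space P \<Longrightarrow> 0 < S n \<omega>"
    "\<And>n y t. (\<forall>l\<le>n. 0 \<le> t l) \<Longrightarrow>
      measure P {\<omega> \<in> space P. \<forall>l\<le>n. Y l \<omega> = y l \<and> t l < S l \<omega>} =
        (if y 0 = k then 1 else 0) * (\<Prod>l<n. jump_prob Q (y l) (y (Suc l)))
          * (\<Prod>l\<le>n. exp (- exit_rate Q (y l) * t l))"
    and X_alive: "\<And>\<omega> t n. \<omega> \<in> space P \<Longrightarrow> 0 \<le> t \<Longrightarrow> (\<Sum>l<n. S l \<omega>) \<le> t \<Longrightarrow> t < (\<Sum>l<Suc n. S l \<omega>) \<Longrightarrow>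
      X t \<omega> = Some (Y n \<omega>)"
    and X_exploded: "\<And>\<omega> t. \<omega> \<in> space P \<Longrightarrow> 0 \<le> t \<Longrightarrow> (\<And>n. (\<Sum>l<n. S l \<omega>) \<le> t) \<Longrightarrow> X t \<omega> = None"
    using process unfolding minimal_Q_process_def
  proof (elim conjE exE, goal_cases)
    case (1 Y S)
    show ?case
      by (rule 1(1)[of Y S]) (use 1(3-) in blast)+
  qed
  interpret prob_space P
    using process by (simp add: minimal_Q_process_def)
  interpret jump_chain_holding_times P Q k Y S
  proof
    show "0 \<le> jump_prob Q i j" for i j
      using m_pos[of i j] rate_pos[of i] by (auto simp: jump_prob_def Q_eq)
  qed (use process_YS rate_pos in auto)
  define v where "v i = (\<Sum>n. taboo_pow Mbar k n i)" for i
  have u_v: "u i = v i * ennreal (1 / (lam - m i i))" for i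
  proof -
    \<comment> \<open>With growth rate \<open>ds i - lam\<close> the row sums cancel: the exit rate
      minus this rate is \<open>lam - m i i\<close>.\<close>
    have "Mbar i j = jump_prob Q i j * (exit_rate Q i / (exit_rate Q i - (ds i - lam)))" for i j
      using rate_pos[of i] by (auto simp: Mbar_eq jump_prob_def Q_eq exit_rate)
    moreover have "ds i - lam < exit_rate Q i" for i
      using lam_gt[of i] by (simp add: exit_rate)
    ultimately show ?thesis
      unfolding u_eq v_def using nn_integral_until_return_eq_taboo[OF X_alive X_exploded, where f = ds and c = lam and A = Mbar and i = i]
      by (simp add: exit_rate)
  qed
  have Mbar_nonneg: "0 \<le> Mbar i j" for i j
    using m_pos[of i j] lam_gt[of i] by (auto simp: Mbar_eq)
  have v_finite: "v i < \<infinity>" for i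
    unfolding v_def using recurrent
    by (rule taboo_pow_suminf_finite) (simp add: Mbar_eq m_pos lam_gt)
  have u_finite: "u i < \<infinity>" for i
    using v_finite[of i] by (simp add: u_v ennreal_mult_less_top)
  have v_real: "enn2real (v i) = (lam - m i i) * enn2real (u i)" for i
    using lam_gt[of i] by (simp add: u_v enn2real_mult)
  have "((\<lambda>i. enn2real (u i) * m i j) has_sum (lam * enn2real (u j))) UNIV" for j
  proof -
    have "((\<lambda>i. enn2real (v i) * Mbar i j) has_sum enn2real (v j)) UNIV"
    proof (rule has_sum_if_nn_integral_count_space)
      have "(\<integral>\<^sup>+i. v i * ennreal (Mbar i j) \<partial>count_space UNIV) = v j"
        unfolding v_def by (rule taboo_pow_suminf_invariant[OF recurrent])
      moreover have "ennreal (enn2real (v i) * Mbar i j) = v i * ennreal (Mbar i j)" for i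
        using v_finite[of i] by (simp add: ennreal_mult Mbar_nonneg)
      ultimately show "(\<integral>\<^sup>+i. ennreal (enn2real (v i) * Mbar i j) \<partial>count_space UNIV) = ennreal (enn2real (v j))"
        using v_finite[of j] by simp
    qed (simp_all add: Mbar_nonneg)
    \<comment> \<open>Restores the diagonal, which is 0 in \<open>Mbar\<close>. On the right,
      \<open>(lam - m j j)\<close> times \<open>u j\<close> is thereby completed to
      \<open>lam\<close> times \<open>u j\<close>.\<close>
    moreover have "((\<lambda>i. if i = j then enn2real (u j) * m j j else 0) has_sum enn2real (u j) * m j j) UNIV"
      using has_sum_finite_neutralI[of "{j}" UNIV "\<lambda>i. if i = j then enn2real (u j) * m j j else 0"] by simp
    ultimately have "((\<lambda>i. enn2real (v i) * Mbar i j + (if i = j then enn2real (u j) * m j j else 0)) has_sum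
        (enn2real (v j) + enn2real (u j) * m j j)) UNIV"
      by (rule has_sum_add)
    moreover have "enn2real (v i) * Mbar i j + (if i = j then enn2real (u j) * m j j else 0) = enn2real (u i) * m i j" for i
      using lam_gt[of i] by (simp add: v_real Mbar_eq)
    moreover have "enn2real (v j) + enn2real (u j) * m j j = lam * enn2real (u j)"
      by (simp add: v_real algebra_simps)
    ultimately show ?thesis by simp
  qed
  with u_finite show ?thesis by blast
qed

end
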